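(* Consider the generalized linear model with natural link and the Bridge estimator $\hat{\boldsymbol\beta}_\lambda$ described in the context, with known $\gamma\in(0,1)$ and tuning parameter $\lambda_n=n^{(\gamma_0-2)/2}\lambda$, where $\lambda>0$ is fixed and $\gamma_0\in(\gamma,1]$. Assume conditions (C1) and (C2) on the regressors, as listed in the context. Then the Bridge estimator has variable selection consistency: with $\hat{\mathcal J}^{(2)}=\{j:\hat\beta_{\lambda,j}\neq0\}$ and $\mathcal J^{(2)}=\{j:\beta^*_j\ne0\}$, $$\mathrm P\big(\hat{\mathcal J}^{(2)}=\mathcal J^{(2)}\big)\to1\quad\text{as } n\to\infty.$$
   Context: Model. Let $f(\boldsymbol y;\boldsymbol\theta)=\exp\{\boldsymbol y^{\rm T}\boldsymbol\theta-a(\boldsymbol\theta)+b(\boldsymbol y)\}$ be a natural exponential family of densities on $\mathbb R^r$ with respect to a $\sigma$-finite measure, where $\boldsymbol\theta\in\Theta\subset\mathbb R^r$ and $\Theta$ is the natural parameter space (those $\boldsymbol\theta$ for which the normalizing integral of $\exp\{\boldsymbol y^{\rm T}\boldsymbol\theta+b(\boldsymbol y)\}$ is positive and finite); $\Theta^\circ$ is its interior. It is assumed that $\mathrm V[\boldsymbol y]=a''(\boldsymbol\theta)$ is positive definite (primes denote gradient and Hessian). The data are $(\boldsymbol y_i,\boldsymbol X_i)$, $i=1,\dots,n$, with $\boldsymbol y_i$ independent $r$-dimensional random vectors and $\boldsymbol X_i\in\mathcal X\subset\mathbb R^{r\times p}$ known constant matrices; $\boldsymbol y_i$ has density $f(\cdot;\boldsymbol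 X_i\boldsymbol\beta^* )$, where $\boldsymbol\beta^*\in\mathcal B$ is the true parameter and $\mathcal B\subset\mathbb R^p$ is an open convex set; $p$ and $r$ are fixed and $n\to\infty$. The log-likelihood of $\boldsymbol y_i$ is $g_i(\boldsymbol\beta)=\boldsymbol y_i^{\rm T}\boldsymbol X_i\boldsymbol\beta-a(\boldsymbol X_i\boldsymbol\beta)+b(\boldsymbol y_i)$. Conditions on regressors. (C1) $\mathcal X$ is compact and $\boldsymbol X\boldsymbol\beta\in\Theta^\circ$ for all $\boldsymbol X\in\mathcal X$, $\boldsymbol\beta\in\mathcal B$. (C2) There exists an invariant distribution $\mu$ on $\mathcal X$; in particular, $n^{-1}\sum_{i=1}^n\boldsymbol X_i^{\rm T}a''(\boldsymbol X_i\boldsymbol\beta)\boldsymbol X_i$ converges to a positive-definite matrix $\boldsymbol J(\boldsymbol\beta)=\int_{\mathcal X}\boldsymbol X^{\rm T}a''(\boldsymbol X\boldsymbol\beta)\boldsymbol X\,\mu(\mathrm d\boldsymbol X)$. Bridge estimator. $\hat{\boldsymbol\beta}_\lambda=\mathrm{argmin}_{\boldsymbol\beta\in\mathcal B}\{-\sum_{i=1}^n g_i(\boldsymbol\beta)+n\lambda_n\sum_{j=1}^p|\beta_j|^\gamma\}$. *)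

theory Defs
  imports "HOL-Probability.Probability"
begin

definition natural_parameter_space ::
    "(real ^ 'r) measure \<Rightarrow> (real ^ 'r \<Rightarrow> real) \<Rightarrow> (real ^ 'r) set" where
  "natural_parameter_space \<nu> b =
     {\<theta>. 0 < (\<integral>\<^sup>+ y. ennreal (exp (y \<bullet> \<theta> + b y)) \<partial>\<nu>) \<and>
          (\<integral>\<^sup>+ y. ennreal (exp (y \<bullet> \<theta> + b y)) \<partial>\<nu>) < \<infinity>}"

(* Only meaningful for \<theta> in the natural parameter space. *)
definition log_partition ::
    "(real ^ 'r) measure \<Rightarrow> (real ^ 'r \<Rightarrow> real) \<Rightarrow> real ^ 'r \<Rightarrow> real" where
  "log_partition \<nu> b \<theta> = ln (LINT y|\<nu>. exp (y \<bullet> \<theta> + b y))"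

definition nef_density ::
    "(real ^ 'r) measure \<Rightarrow> (real ^ 'r \<Rightarrow> real) \<Rightarrow> real ^ 'r \<Rightarrow> real ^ 'r \<Rightarrow> real" where
  "nef_density \<nu> b \<theta> y = exp (y \<bullet> \<theta> - log_partition \<nu> b \<theta> + b y)"

definition gradient :: "(real ^ 'r \<Rightarrow> real) \<Rightarrow> real ^ 'r \<Rightarrow> real ^ 'r" where
  "gradient f x = (\<chi> i. frechet_derivative f (at x) (axis i 1))"

definition hessian :: "(real ^ 'r \<Rightarrow> real) \<Rightarrow> real ^ 'r \<Rightarrow> real ^ 'r ^ 'r" where
  "hessian f x = jacobian (gradient f) (at x)"

definition positive_definite :: "real ^ 'k ^ 'k \<Rightarrow> bool" where
  "positive_definite A \<longleftrightarrow> transpose A = A \<and> (\<forall>v. v \<noteq> 0 \<longrightarrow> 0 < v \<bullet> (A *v v))"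

(* Contribution to the Fisher information of one observation with regressor matrix X. *)
definition information ::
    "(real ^ 'r) measure \<Rightarrow> (real ^ 'r \<Rightarrow> real) \<Rightarrow> real ^ 'p \<Rightarrow> real ^ 'p ^ 'r \<Rightarrow> real ^ 'p ^ 'p" where
  "information \<nu> b \<beta> X = transpose X ** hessian (log_partition \<nu> b) (X *v \<beta>) ** X"

definition log_lik ::
    "(real ^ 'r) measure \<Rightarrow> (real ^ 'r \<Rightarrow> real) \<Rightarrow> real ^ 'p ^ 'r \<Rightarrow> real ^ 'r \<Rightarrow> real ^ 'p \<Rightarrow> real" where
  "log_lik \<nu> b X y \<beta> = y \<bullet> (X *v \<beta>) - log_partition \<nu> b (X *v \<beta>) + b y"

definition bridge_objective ::
    "(real ^ 'r) measure \<Rightarrow> (real ^ 'r \<Rightarrow> real) \<Rightarrow> (nat \<Rightarrow> real ^ 'p ^ 'r) \<Rightarrow> (nat \<Rightarrow> real ^ 'r)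
      \<Rightarrow> real \<Rightarrow> real \<Rightarrow> nat \<Rightarrow> real ^ 'p \<Rightarrow> real" where
  "bridge_objective \<nu> b X y \<gamma> l n \<beta> =
     - (\<Sum>i=1..n. log_lik \<nu> b (X i) (y i) \<beta>) + real n * l * (\<Sum>j\<in>UNIV. \<bar>\<beta> $ j\<bar> powr \<gamma>)"

end

theory Submission
  imports Defs
begin

text \<open>
  The negative log-likelihood \<open>L\<close> is convex. Around the true parameter it is, by the second
  order expansion of the log-partition function and convergence of the averaged information, squeezed
  between quadratics \<open>c n h\<^sup>2 - |U| h\<close> and \<open>C n h\<^sup>2 + |U| h\<close>, where \<open>h\<close> is the distance to the true
  parameter and the score \<open>U\<close> is a sum of independent centred vectors, hence \<open>O(\<surd>n)\<close> in probability
  by Chebyshev. Convexity makes the lower bound linear outside a small ball, so a minimizer exists, and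
  comparison with the true parameter puts it at distance \<open>O(1/\<surd>n)\<close>: the penalty on the
  nonzero coordinates is Lipschitz there and has weight at most \<open>\<surd>n\<close>. This rules out missed
  coordinates. Setting a spurious coordinate \<open>t\<close> to zero raises \<open>L\<close> by at most \<open>O(\<surd>n |t|)\<close>, again by
  convexity, but saves \<open>\<kappa> n powr (\<gamma>\<^sub>0/2) |t| powr \<gamma>\<close> in the penalty, which is larger since
  \<open>|t| = O(1/\<surd>n)\<close> and \<open>\<gamma> < \<gamma>\<^sub>0\<close>.
\<close>

section \<open>Bridge penalty and convex losses\<close>

text \<open>The slope \<open>\<bar>s\<bar> powr (\<gamma> - 1)\<close> is that of the chord from the
  origin to the graph at \<open>\<bar>s\<bar>\<close>. A concave power lies above this chord on
  \<open>[0, \<bar>s\<bar>]\<close>. For larger \<open>\<bar>t\<bar>\<close> the left side is not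
  positive.\<close>

lemma powr_ge_tangent:
  fixes s t \<gamma> :: real
  assumes "0 < \<gamma>" "\<gamma> < 1" "s \<noteq> 0"
  shows "\<bar>s\<bar> powr \<gamma> - \<bar>t\<bar> powr \<gamma> \<le> \<bar>s\<bar> powr (\<gamma> - 1) * \<bar>t - s\<bar>"
proof (cases "\<bar>t\<bar> \<le> \<bar>s\<bar>")
  case True
  have s: "\<bar>s\<bar> powr \<gamma> = \<bar>s\<bar> powr (\<gamma> - 1) * \<bar>s\<bar>"
    using assms by (simp add: powr_diff)
  have "\<bar>s\<bar> powr (\<gamma> - 1) * \<bar>t\<bar> \<le> \<bar>t\<bar> powr \<gamma>"
  proof (cases "t = 0")
    case False
    have "\<bar>s\<bar> powr (\<gamma> - 1) \<le> \<bar>t\<bar> powr (\<gamma> - 1)"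
      using True False assms by (intro powr_mono2') auto
    then have "\<bar>s\<bar> powr (\<gamma> - 1) * \<bar>t\<bar> \<le> \<bar>t\<bar> powr (\<gamma> - 1) * \<bar>t\<bar>"
      by (intro mult_right_mono) auto
    also have "\<dots> = \<bar>t\<bar> powr \<gamma>"
      using False by (simp add: powr_diff)
    finally show ?thesis .
  qed simp
  then have "\<bar>s\<bar> powr \<gamma> - \<bar>t\<bar> powr \<gamma> \<le> \<bar>s\<bar> powr (\<gamma> - 1) * (\<bar>s\<bar> - \<bar>t\<bar>)"
    by (simp add: s right_diff_distrib)
  also have "\<dots> \<le> \<bar>s\<bar> powr (\<gamma> - 1) * \<bar>t - s\<bar>"
    by (intro mult_left_mono) auto
  finally show ?thesis .
next
  case False
  then have "\<bar>s\<bar> powr \<gamma> \<le> \<bar>t\<bar> powr \<gamma>"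
    using assms by (intro powr_mono2) auto
  then show ?thesis
    by (smt (verit) mult_nonneg_nonneg powr_ge_zero)
qed

text \<open>A one-sided Lipschitz bound at \<open>\<beta>\<^sub>0\<close>, obtained coordinate by
  coordinate from the chord estimate. Zero coordinates of \<open>\<beta>\<^sub>0\<close> cost
  nothing: moving them can only increase the penalty of \<open>\<beta>\<close>, and
  \<open>0 powr (\<gamma> - 1)\<close> is 0 by convention.\<close>

lemma bridge_penalty_diff:
  fixes \<beta> \<beta>\<^sub>0 :: "real ^ 'p"
  assumes "0 < \<gamma>" "\<gamma> < 1"
  shows "(\<Sum>j\<in>UNIV. \<bar>\<beta>\<^sub>0 $ j\<bar> powr \<gamma>) - (\<Sum>j\<in>UNIV. \<bar>\<beta> $ j\<bar> powr \<gamma>)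
    \<le> (\<Sum>j\<in>UNIV. \<bar>\<beta>\<^sub>0 $ j\<bar> powr (\<gamma> - 1)) * norm (\<beta> - \<beta>\<^sub>0)"
proof -
  have "\<bar>\<beta>\<^sub>0 $ j\<bar> powr \<gamma> - \<bar>\<beta> $ j\<bar> powr \<gamma> \<le> \<bar>\<beta>\<^sub>0 $ j\<bar> powr (\<gamma> - 1) * norm (\<beta> - \<beta>\<^sub>0)" for j
  proof (cases "\<beta>\<^sub>0 $ j = 0")
    case False
    have "\<bar>\<beta> $ j - \<beta>\<^sub>0 $ j\<bar> \<le> norm (\<beta> - \<beta>\<^sub>0)"
      using component_le_norm_cart[of "\<beta> - \<beta>\<^sub>0" j] by simp
    then show ?thesis
      using powr_ge_tangent[OF assms False, of "\<beta> $ j"]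
      by (meson mult_left_mono order_trans powr_ge_zero)
  qed (use assms in auto)
  then show ?thesis
    by (auto simp: sum_subtractf[symmetric] sum_distrib_right intro: sum_mono)
qed

text \<open>The segment from \<open>x\<close> to \<open>z\<close> crosses the sphere at a point
  \<open>p\<close>. Convexity bounds the rise at \<open>p\<close> by the fraction
  \<open>u \<le> 1\<close> of the rise at \<open>z\<close>.\<close>

lemma convex_on_ge_outside_ball:
  fixes L :: "'a::real_normed_vector \<Rightarrow> real"
  assumes "convex_on B L" "x \<in> B" "z \<in> B" "0 < \<delta>" "\<delta> \<le> norm (z - x)" "0 \<le> m"
    and sphere: "\<And>p. norm (p - x) = \<delta> \<Longrightarrow> L x + m \<le> L p"
  shows "L x + m \<le> L z"
proof -
  define u where "u = \<delta> / norm (z - x)"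
  have u: "0 < u" "u \<le> 1"
    using assms by (auto simp: u_def divide_simps)
  define p where "p = (1 - u) *\<^sub>R x + u *\<^sub>R z"
  have "p - x = u *\<^sub>R (z - x)"
    by (simp add: p_def algebra_simps)
  moreover have "z \<noteq> x"
    using assms by auto
  ultimately have "norm (p - x) = \<delta>"
    using assms u by (simp add: u_def)
  then have "L x + m \<le> L p"
    by (rule sphere)
  also have "\<dots> \<le> (1 - u) * L x + u * L z"
    unfolding p_def using assms u by (intro convex_onD[OF assms(1)]) auto
  finally have "m \<le> u * (L z - L x)"
    by (simp add: algebra_simps)
  \<comment> \<open>Enlarging the factor \<open>u\<close> to 1 requires a nonnegative rise; here
    \<open>0 \<le> m\<close> enters.\<close>
  moreover from this have "0 \<le> L z - L x"
    using u \<open>0 \<le> m\<close> by (smt (verit) mult_pos_neg)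
  then have "u * (L z - L x) \<le> 1 * (L z - L x)"
    using u by (intro mult_right_mono) auto
  ultimately show ?thesis by simp
qed

text \<open>Here \<open>N\<close> plays the role of the square root of the sample size.\<close>

lemma bridge_argmin_support:
  fixes \<beta>\<^sub>0 :: "real ^ 'p"
  assumes B: "open B" "cball \<beta>\<^sub>0 \<delta> \<subseteq> B" and pos: "0 < \<delta>" "0 < c" "0 \<le> K" "0 \<le> C" "0 < \<kappa>"
    and \<gamma>: "0 < \<gamma>" "\<gamma> < 1" "\<gamma> < \<gamma>\<^sub>0" "\<gamma>\<^sub>0 \<le> 1"
  shows "\<forall>\<^sub>F N in at_top. \<forall>L obj. convex_on B L \<longrightarrow>
    (\<forall>\<beta>\<in>cball \<beta>\<^sub>0 \<delta>.
        c * N\<^sup>2 * (norm (\<beta> - \<beta>\<^sub>0))\<^sup>2 - K * N * norm (\<beta> - \<beta>\<^sub>0) \<le> L \<beta> - L \<beta>\<^sub>0 \<and>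
        L \<beta> - L \<beta>\<^sub>0 \<le> C * N\<^sup>2 * (norm (\<beta> - \<beta>\<^sub>0))\<^sup>2 + K * N * norm (\<beta> - \<beta>\<^sub>0)) \<longrightarrow>
    (\<forall>\<beta>. obj \<beta> = L \<beta> + \<kappa> * N powr \<gamma>\<^sub>0 * (\<Sum>j\<in>UNIV. \<bar>\<beta> $ j\<bar> powr \<gamma>)) \<longrightarrow>
    (\<exists>\<beta>. is_arg_min obj (\<lambda>\<beta>. \<beta> \<in> B) \<beta>) \<and>
    (\<forall>\<beta>. is_arg_min obj (\<lambda>\<beta>. \<beta> \<in> B) \<beta> \<longrightarrow> {j. \<beta> $ j \<noteq> 0} = {j. \<beta>\<^sub>0 $ j \<noteq> 0})"
proof -
  define pen where "pen = (\<lambda>\<beta>::real^'p. \<Sum>j\<in>UNIV. \<bar>\<beta> $ j\<bar> powr \<gamma>)"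
  \<comment> \<open>\<open>D\<close> is the one-sided Lipschitz constant of the penalty at
    \<open>\<beta>\<^sub>0\<close>.\<close>
  define D where "D = (\<Sum>j\<in>UNIV. \<bar>\<beta>\<^sub>0 $ j\<bar> powr (\<gamma> - 1))"
  \<comment> \<open>For a minimizer at distance \<open>h\<close>,
    \<open>c N\<^sup>2 h\<^sup>2 - K N h \<le> \<kappa> N D h\<close> will hold; cancelling
    \<open>N h\<close> gives \<open>N h \<le> R\<close>.\<close>
  define R where "R = (K + \<kappa> * D) / c"
  \<comment> \<open>The smallest nonzero coordinate in absolute value, capped at 1; the inserted 1
    keeps the set nonempty when \<open>\<beta>\<^sub>0 = 0\<close>.\<close>
  define m where "m = Min (insert 1 ((\<lambda>j. \<bar>\<beta>\<^sub>0 $ j\<bar>) ` {j. \<beta>\<^sub>0 $ j \<noteq> 0}))"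
  \<comment> \<open>\<open>Q\<close> bounds \<open>L p - L z\<close> for points at distances at most
    \<open>(R + 1) / N\<close> and \<open>R / N\<close> from \<open>\<beta>\<^sub>0\<close>: the
    first two summands come from the upper bound at \<open>p\<close>, the last one from the lower
    bound at \<open>z\<close>.\<close>
  define Q where "Q = C * (R + 1)\<^sup>2 + K * (R + 1) + K * R"
  have pen_nonneg: "0 \<le> pen \<beta>" for \<beta>
    by (simp add: pen_def sum_nonneg)
  have D: "0 \<le> D"
    by (simp add: D_def sum_nonneg)
  have R: "0 \<le> R"
    using D pos by (simp add: R_def)
  have m: "0 < m"
    by (auto simp: m_def)
  have m_le: "m \<le> \<bar>\<beta>\<^sub>0 $ j\<bar>" if "\<beta>\<^sub>0 $ j \<noteq> 0" for j
    using that by (auto simp: m_def)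
  \<comment> \<open>Three thresholds on \<open>N\<close>. The first lets the quadratic growth on the
    sphere of radius \<open>\<delta>\<close> exceed the whole penalty at
    \<open>\<beta>\<^sub>0\<close>. The second makes the scale \<open>1 / N\<close> small against
    \<open>m\<close> and \<open>\<delta>\<close>.\<close>
  have ev1: "\<forall>\<^sub>F N in at_top. (K * \<delta> + \<kappa> * pen \<beta>\<^sub>0) / (c * \<delta>\<^sup>2) < N"
    by (rule eventually_gt_at_top)
  have ev2: "\<forall>\<^sub>F N in at_top. max (R / m) ((R + 1) / \<delta>) < N"
    by (rule eventually_gt_at_top)
  \<comment> \<open>The third threshold rests on \<open>\<gamma> < \<gamma>\<^sub>0\<close>, which
    makes the power of \<open>N\<close> vanish in the limit; it yields the final contradiction for
    spurious coordinates.\<close>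
  have "((\<lambda>N. Q * R powr (1 - \<gamma>) * N powr (- (\<gamma>\<^sub>0 - \<gamma>))) \<longlongrightarrow> Q * R powr (1 - \<gamma>) * 0) at_top"
    using \<gamma> by (intro tendsto_mult_left tendsto_neg_powr filterlim_ident) auto
  then have ev3: "\<forall>\<^sub>F N in at_top. Q * R powr (1 - \<gamma>) * N powr (- (\<gamma>\<^sub>0 - \<gamma>)) < \<kappa>"
    using pos by (intro order_tendstoD) auto
  show ?thesis
    using ev1 ev2 ev3 eventually_ge_at_top[of 1]
  proof eventually_elim
    case (elim N)
    have N: "1 \<le> N" "0 < N" using elim by auto
    have RN: "R / N < m" "(R + 1) / N < \<delta>"
      using elim(2) N pos m by (auto simp: field_simps)
    have powN: "N powr \<gamma>\<^sub>0 \<le> N"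
      using powr_mono[of \<gamma>\<^sub>0 1 N] N \<gamma> by simp
    show ?case
    proof (intro allI impI)
      fix L obj :: "real ^ 'p \<Rightarrow> real"
      assume conv: "convex_on B L"
        and quad: "\<forall>\<beta>\<in>cball \<beta>\<^sub>0 \<delta>.
          c * N\<^sup>2 * (norm (\<beta> - \<beta>\<^sub>0))\<^sup>2 - K * N * norm (\<beta> - \<beta>\<^sub>0) \<le> L \<beta> - L \<beta>\<^sub>0 \<and>
          L \<beta> - L \<beta>\<^sub>0 \<le> C * N\<^sup>2 * (norm (\<beta> - \<beta>\<^sub>0))\<^sup>2 + K * N * norm (\<beta> - \<beta>\<^sub>0)"
        and "\<forall>\<beta>. obj \<beta> = L \<beta> + \<kappa> * N powr \<gamma>\<^sub>0 * (\<Sum>j\<in>UNIV. \<bar>\<beta> $ j\<bar> powr \<gamma>)"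
      then have obj: "obj \<beta> = L \<beta> + \<kappa> * N powr \<gamma>\<^sub>0 * pen \<beta>" for \<beta>
        by (simp add: pen_def)
      have lower: "c * N\<^sup>2 * (norm (\<beta> - \<beta>\<^sub>0))\<^sup>2 - K * N * norm (\<beta> - \<beta>\<^sub>0) \<le> L \<beta> - L \<beta>\<^sub>0"
        and upper: "L \<beta> - L \<beta>\<^sub>0 \<le> C * N\<^sup>2 * (norm (\<beta> - \<beta>\<^sub>0))\<^sup>2 + K * N * norm (\<beta> - \<beta>\<^sub>0)"
        if "norm (\<beta> - \<beta>\<^sub>0) \<le> \<delta>" for \<beta>
        using quad that by (auto simp: dist_norm norm_minus_commute)
      have \<beta>\<^sub>0: "\<beta>\<^sub>0 \<in> B"
        using B pos by auto

      \<comment> \<open>Outside the ball the loss exceeds \<open>L \<beta>\<^sub>0\<close> by at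
        least its guaranteed rise \<open>d\<close> on the sphere. Since \<open>d\<close> exceeds the
        weighted penalty at \<open>\<beta>\<^sub>0\<close>, no saving in the penalty can make up for
        it.\<close>
      have outside: "obj \<beta>\<^sub>0 < obj \<beta>" if "\<beta> \<in> B" "\<beta> \<notin> cball \<beta>\<^sub>0 \<delta>" for \<beta>
      proof -
        define d where "d = c * N\<^sup>2 * \<delta>\<^sup>2 - K * N * \<delta>"
        have "K * \<delta> + \<kappa> * pen \<beta>\<^sub>0 < c * \<delta>\<^sup>2 * N"
          using elim(1) pos by (simp add: field_simps)
        then have "(K * \<delta> + \<kappa> * pen \<beta>\<^sub>0) * N < c * \<delta>\<^sup>2 * N * N"
          using N by (intro mult_strict_right_mono) auto
        then have d: "\<kappa> * N * pen \<beta>\<^sub>0 < d"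
          by (simp add: d_def power2_eq_square algebra_simps)
        moreover have "0 \<le> \<kappa> * N * pen \<beta>\<^sub>0"
          using N pos pen_nonneg by simp
        ultimately have "0 \<le> d" by simp
        then have "L \<beta>\<^sub>0 + d \<le> L \<beta>"
        proof (rule convex_on_ge_outside_ball[OF conv \<beta>\<^sub>0 that(1) pos(1), rotated])
          show "L \<beta>\<^sub>0 + d \<le> L p" if "norm (p - \<beta>\<^sub>0) = \<delta>" for p
            using lower[of p] that by (simp add: d_def)
        qed (use that in \<open>auto simp: dist_norm norm_minus_commute\<close>)
        moreover have "\<kappa> * N powr \<gamma>\<^sub>0 * pen \<beta>\<^sub>0 \<le> \<kappa> * N * pen \<beta>\<^sub>0"
          using powN pos pen_nonneg by (intro mult_right_mono mult_left_mono) auto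
        moreover have "0 \<le> \<kappa> * N powr \<gamma>\<^sub>0 * pen \<beta>"
          using pos pen_nonneg by simp
        ultimately show ?thesis
          using d by (simp add: obj)
      qed

      \<comment> \<open>Existence: a convex function on an open set is continuous, so the objective
        has a minimum on the compact ball. This minimum is global because every point of
        \<open>B\<close> outside the ball is worse than the centre.\<close>
      have "continuous_on B L"
        by (rule convex_on_continuous[OF B(1) conv])
      then have "continuous_on (cball \<beta>\<^sub>0 \<delta>) obj"
        unfolding obj pen_def using \<gamma> B
        by (intro continuous_intros continuous_on_powr') (auto intro: continuous_on_subset)
      then obtain \<beta>m where \<beta>m: "\<beta>m \<in> cball \<beta>\<^sub>0 \<delta>" "\<And>\<beta>. \<beta> \<in> cball \<beta>\<^sub>0 \<delta> \<Longrightarrow> obj \<beta>m \<le> obj \<beta>"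
        using continuous_attains_inf[of "cball \<beta>\<^sub>0 \<delta>" obj] pos by auto
      have "obj \<beta>m \<le> obj \<beta>" if "\<beta> \<in> B" for \<beta>
        using \<beta>m(2)[of \<beta>] \<beta>m(2)[of \<beta>\<^sub>0] outside[OF that] pos by fastforce
      then have ex: "\<exists>\<beta>. is_arg_min obj (\<lambda>\<beta>. \<beta> \<in> B) \<beta>"
        using \<beta>m(1) B by (auto simp: is_arg_min_def not_less intro!: exI[of _ \<beta>m])

      have "{j. \<beta> $ j \<noteq> 0} = {j. \<beta>\<^sub>0 $ j \<noteq> 0}" if "is_arg_min obj (\<lambda>\<beta>. \<beta> \<in> B) \<beta>" for \<beta>
      proof -
        have \<beta>: "\<beta> \<in> B" and min: "\<And>z. z \<in> B \<Longrightarrow> obj \<beta> \<le> obj z"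
          using that by (auto simp: is_arg_min_def not_less)
        define h where "h = norm (\<beta> - \<beta>\<^sub>0)"
        have h0: "0 \<le> h" by (simp add: h_def)
        have h\<delta>: "h \<le> \<delta>"
          using outside[OF \<beta>] min[OF \<beta>\<^sub>0] by (force simp: h_def dist_norm norm_minus_commute)
        \<comment> \<open>Comparison with \<open>\<beta>\<^sub>0\<close>: the rise of the loss is at
          most the drop in the penalty, and that drop is at most linear in \<open>h\<close>.\<close>
        have "h \<le> R / N"
        proof (cases "h = 0")
          case False
          have "c * N\<^sup>2 * h\<^sup>2 - K * N * h \<le> L \<beta> - L \<beta>\<^sub>0"
            using lower h\<delta> by (simp add: h_def)
          also have "\<dots> \<le> \<kappa> * N powr \<gamma>\<^sub>0 * (pen \<beta>\<^sub>0 - pen \<beta>)"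
            using min[OF \<beta>\<^sub>0] by (simp add: obj algebra_simps)
          also have "\<dots> \<le> \<kappa> * N powr \<gamma>\<^sub>0 * (D * h)"
            using bridge_penalty_diff[of \<gamma> \<beta>\<^sub>0 \<beta>] \<gamma> pos
            by (intro mult_left_mono) (auto simp: pen_def D_def h_def)
          also have "\<dots> \<le> \<kappa> * N * (D * h)"
            using powN pos D h0 by (intro mult_right_mono mult_left_mono) auto
          finally have "(N * h) * (c * N * h) \<le> (N * h) * (K + \<kappa> * D)"
            by (simp add: power2_eq_square algebra_simps)
          then have "c * N * h \<le> K + \<kappa> * D"
            using False h0 N by (simp add: mult_le_cancel_left_pos)
          then show ?thesis
            using pos N by (simp add: R_def field_simps)
        qed (use R N in simp)
        note hR = this

        \<comment> \<open>A missed coordinate would put \<open>\<beta>\<close> at distance at least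
          \<open>m\<close> from \<open>\<beta>\<^sub>0\<close>, more than
          \<open>R / N\<close>.\<close>
        have "\<beta> $ j \<noteq> 0" if "\<beta>\<^sub>0 $ j \<noteq> 0" for j
        proof
          assume "\<beta> $ j = 0"
          then have "\<bar>\<beta>\<^sub>0 $ j\<bar> \<le> h"
            using component_le_norm_cart[of "\<beta> - \<beta>\<^sub>0" j] by (simp add: h_def)
          then show False
            using m_le[OF that] hR RN by simp
        qed
        moreover have "\<beta> $ j = 0" if \<beta>\<^sub>0j: "\<beta>\<^sub>0 $ j = 0" for j
        proof (rule ccontr)
          assume ne: "\<beta> $ j \<noteq> 0"
          define t where "t = \<beta> $ j"
          \<comment> \<open>\<open>z\<close> deletes the spurious coordinate, and \<open>p\<close>
            continues beyond \<open>z\<close> by a further \<open>1 / N\<close> in the same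
            direction. So \<open>z\<close> lies between \<beta> and \<open>p\<close>, and convexity
            bounds the slope of \<open>L\<close> from \<beta> to \<open>z\<close> by its slope from
            \<open>z\<close> to \<open>p\<close>, where the step length is known.\<close>
          define z where "z = \<beta> - axis j t"
          define p where "p = z - axis j (sgn t / N)"
          have t: "t \<noteq> 0" using ne by (simp add: t_def)
          have th: "\<bar>t\<bar> \<le> h"
            using component_le_norm_cart[of "\<beta> - \<beta>\<^sub>0" j] by (simp add: h_def t_def \<beta>\<^sub>0j)
          have zh: "norm (z - \<beta>\<^sub>0) \<le> h"
            unfolding h_def by (rule norm_le_componentwise_cart)
              (auto simp: z_def t_def axis_def \<beta>\<^sub>0j)
          have "norm (p - \<beta>\<^sub>0) \<le> norm (z - \<beta>\<^sub>0) + norm (axis j (sgn t / N))"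
            using norm_triangle_ineq4[of "z - \<beta>\<^sub>0" "axis j (sgn t / N)"] by (simp add: p_def algebra_simps)
          also have "norm (axis j (sgn t / N)) = 1 / N"
            using t N by (simp add: norm_eq_sqrt_inner inner_axis_axis abs_sgn_eq real_sqrt_divide)
          finally have ph: "norm (p - \<beta>\<^sub>0) \<le> (R + 1) / N"
            using zh hR by (simp add: add_divide_distrib)
          have zB: "z \<in> B" and pB: "p \<in> B"
            using B(2) zh h\<delta> ph RN by (auto simp: subset_iff dist_norm norm_minus_commute)
          \<comment> \<open>The weight of \<open>p\<close> in the convex combination that equals
            \<open>z\<close>: the pieces of the segment have lengths \<open>\<bar>t\<bar>\<close>
            and \<open>1 / N\<close>.\<close>
          define u where "u = \<bar>t\<bar> / (\<bar>t\<bar> + 1 / N)"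
          have u: "0 < u" "u < 1"
            using t N by (auto simp: u_def divide_simps add_pos_pos)
          have u1: "(\<bar>t\<bar> + 1 / N) * u = \<bar>t\<bar>"
            using t N by (simp add: u_def add_nonneg_eq_0_iff)
          have "(1 - u) * t = u * (sgn t / N)"
          proof -
            have "(\<bar>t\<bar> + 1 / N) * ((1 - u) * t) = (\<bar>t\<bar> + 1 / N) * t - ((\<bar>t\<bar> + 1 / N) * u) * t"
              by (simp add: algebra_simps)
            also have "\<dots> = t / N" unfolding u1 by (simp add: algebra_simps)
            also have "\<dots> = ((\<bar>t\<bar> + 1 / N) * u) * (sgn t / N)"
              unfolding u1 by (simp add: abs_mult_sgn)
            finally have "(\<bar>t\<bar> + 1 / N) * ((1 - u) * t) = (\<bar>t\<bar> + 1 / N) * (u * (sgn t / N))"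
              by (simp add: mult.assoc)
            moreover have "\<bar>t\<bar> + 1 / N \<noteq> 0"
              using N by (simp add: add_nonneg_eq_0_iff)
            ultimately show ?thesis
              using mult_left_cancel by blast
          qed
          then have "(1 - u) *\<^sub>R axis j t = u *\<^sub>R axis j (sgn t / N)"
            by (simp add: vec_eq_iff axis_def)
          then have "z = (1 - u) *\<^sub>R \<beta> + u *\<^sub>R p"
            unfolding p_def z_def by (simp add: algebra_simps)
          then have "L z \<le> (1 - u) * L \<beta> + u * L p"
            using convex_onD[OF conv _ _ \<beta> pB, of u] u by simp
          then have "(\<bar>t\<bar> + 1 / N) * L z \<le> (\<bar>t\<bar> + 1 / N) * ((1 - u) * L \<beta> + u * L p)"
            using N by (intro mult_left_mono) auto
          also have "\<dots> = (\<bar>t\<bar> + 1 / N) * L \<beta> + ((\<bar>t\<bar> + 1 / N) * u) * (L p - L \<beta>)"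
            by (simp add: algebra_simps)
          finally have slope: "L z - L \<beta> \<le> N * \<bar>t\<bar> * (L p - L z)"
            unfolding u1 using N mult_le_cancel_left_pos[of N "L z + N * (\<bar>t\<bar> * L z)" "L \<beta> + N * (\<bar>t\<bar> * L p)"]
            by (simp add: field_simps)
          \<comment> \<open>At distances of order \<open>1 / N\<close> the factors of
            \<open>N\<close> in the quadratic bounds cancel, which leaves constants independent of
            \<open>N\<close>.\<close>
          have pR: "N * norm (p - \<beta>\<^sub>0) \<le> R + 1" and zR: "N * norm (z - \<beta>\<^sub>0) \<le> R"
            using ph order_trans[OF zh hR] N by (auto simp: field_simps)
          have "L p - L \<beta>\<^sub>0 \<le> C * (N * norm (p - \<beta>\<^sub>0))\<^sup>2 + K * (N * norm (p - \<beta>\<^sub>0))"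
            using upper[of p] ph RN by (simp add: power_mult_distrib algebra_simps)
          also have "\<dots> \<le> C * (R + 1)\<^sup>2 + K * (R + 1)"
            using pR pos R N by (intro add_mono mult_left_mono power_mono) auto
          finally have "L p - L \<beta>\<^sub>0 \<le> C * (R + 1)\<^sup>2 + K * (R + 1)" .
          moreover have "L \<beta>\<^sub>0 - L z \<le> K * R"
          proof -
            have "0 \<le> c * N\<^sup>2 * (norm (z - \<beta>\<^sub>0))\<^sup>2"
              using pos by simp
            then have "L \<beta>\<^sub>0 - L z \<le> K * (N * norm (z - \<beta>\<^sub>0))"
              using lower[of z] zh h\<delta> by simp
            also have "\<dots> \<le> K * R"
              using zR pos by (intro mult_left_mono) auto
            finally show ?thesis .
          qed
          ultimately have "L p - L z \<le> Q"
            by (simp add: Q_def)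
          then have "N * \<bar>t\<bar> * (L p - L z) \<le> N * \<bar>t\<bar> * Q"
            using N by (intro mult_left_mono) auto
          with slope have Lz: "L z - L \<beta> \<le> N * \<bar>t\<bar> * Q"
            by simp
          have "pen \<beta> = pen z + \<bar>t\<bar> powr \<gamma>"
          proof -
            have "pen \<beta> = \<bar>\<beta> $ j\<bar> powr \<gamma> + (\<Sum>i\<in>UNIV - {j}. \<bar>\<beta> $ i\<bar> powr \<gamma>)"
              unfolding pen_def by (rule sum.remove) auto
            moreover have "pen z = \<bar>z $ j\<bar> powr \<gamma> + (\<Sum>i\<in>UNIV - {j}. \<bar>z $ i\<bar> powr \<gamma>)"
              unfolding pen_def by (rule sum.remove) auto
            moreover have "(\<Sum>i\<in>UNIV - {j}. \<bar>z $ i\<bar> powr \<gamma>) = (\<Sum>i\<in>UNIV - {j}. \<bar>\<beta> $ i\<bar> powr \<gamma>)"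
              by (intro sum.cong) (auto simp: z_def axis_def)
            ultimately show ?thesis
              by (simp add: z_def t_def axis_def)
          qed
          \<comment> \<open>By minimality the penalty saved at \<open>z\<close> is at most the rise
            in loss. After cancelling \<open>\<bar>t\<bar> powr \<gamma>\<close>, the positive
            exponent \<open>1 - \<gamma>\<close> allows \<open>\<bar>t\<bar>\<close> to be replaced
            by its bound \<open>R / N\<close>; the result contradicts the third threshold.\<close>
          then have "\<kappa> * N powr \<gamma>\<^sub>0 * \<bar>t\<bar> powr \<gamma> \<le> L z - L \<beta>"
            using min[OF zB] by (simp add: obj algebra_simps)
          also have "\<dots> \<le> \<bar>t\<bar> powr \<gamma> * (N * \<bar>t\<bar> powr (1 - \<gamma>) * Q)"
            using Lz t by (simp add: powr_diff)
          finally have "\<kappa> * N powr \<gamma>\<^sub>0 \<le> N * \<bar>t\<bar> powr (1 - \<gamma>) * Q"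
            using t by (simp add: mult.commute)
          also have "\<dots> \<le> N * (R / N) powr (1 - \<gamma>) * Q"
            using th hR \<gamma> N pos R
            by (intro mult_right_mono mult_left_mono powr_mono2) (auto simp: Q_def)
          also have "\<dots> = N powr \<gamma> * (Q * R powr (1 - \<gamma>))"
            using N R by (simp add: powr_divide powr_diff)
          also have "\<dots> = N powr \<gamma>\<^sub>0 * (Q * R powr (1 - \<gamma>) * N powr (- (\<gamma>\<^sub>0 - \<gamma>)))"
            using N by (simp add: powr_add[symmetric])
          also have "\<dots> < N powr \<gamma>\<^sub>0 * \<kappa>"
            using elim(3) N by (intro mult_strict_left_mono) auto
          finally show False by simp
        qed
        ultimately show ?thesis by auto
      qed
      with ex show "(\<exists>\<beta>. is_arg_min obj (\<lambda>\<beta>. \<beta> \<in> B) \<beta>) \<and>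
        (\<forall>\<beta>. is_arg_min obj (\<lambda>\<beta>. \<beta> \<in> B) \<beta> \<longrightarrow> {j. \<beta> $ j \<noteq> 0} = {j. \<beta>\<^sub>0 $ j \<noteq> 0})"
        by blast
    qed
  qed
qed

section \<open>Smoothness of the log-partition function\<close>

text \<open>Lagrange form of the remainder with the factor 1/2 dropped. It is applied to
  \<open>x = y \<bullet> h\<close>, where a small exponential moment dominates the right
  side.\<close>

lemma abs_exp_remainder_le:
  fixes x :: real
  shows "\<bar>exp x - 1 - x\<bar> \<le> x\<^sup>2 * exp \<bar>x\<bar>"
proof -
  obtain t where t: "\<bar>t\<bar> \<le> \<bar>x\<bar>" "exp x = (\<Sum>m<2. x ^ m / fact m) + exp t / fact 2 * x ^ 2"
    using Maclaurin_exp_le[of x 2] by blast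
  then have "\<bar>exp x - 1 - x\<bar> = exp t / 2 * x\<^sup>2"
    by (simp add: numeral_2_eq_2)
  also have "\<dots> \<le> exp \<bar>x\<bar> * x\<^sup>2"
  proof (intro mult_right_mono)
    have "exp t \<le> exp \<bar>x\<bar>" using t by simp
    then show "exp t / 2 \<le> exp \<bar>x\<bar>" using exp_gt_zero[of t] by linarith
  qed simp
  finally show ?thesis by (simp add: mult.commute)
qed

text \<open>A class of integrands whose moments are finite at every interior parameter. It contains
  the coordinates and the norm. Quantifying over all \<epsilon> makes it closed under products,
  since \<epsilon> can be split in half.\<close>

definition subexponential :: "('a::real_normed_vector \<Rightarrow> real) \<Rightarrow> bool" where
  "subexponential g \<longleftrightarrow> (\<forall>\<epsilon>>0. \<exists>C\<ge>0. \<forall>y. \<bar>g y\<bar> \<le> C * exp (\<epsilon> * norm y))"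

lemma subexponential_const [simp, intro]: "subexponential (\<lambda>y. c)"
  unfolding subexponential_def
proof (intro allI impI exI[of _ "\<bar>c\<bar>"] conjI)
  fix \<epsilon> :: real and y :: 'a assume "0 < \<epsilon>"
  then have "\<bar>c\<bar> * 1 \<le> \<bar>c\<bar> * exp (\<epsilon> * norm y)"
    by (intro mult_left_mono) auto
  then show "\<bar>c\<bar> \<le> \<bar>c\<bar> * exp (\<epsilon> * norm y)" by simp
qed simp

lemma subexponential_norm [simp, intro]: "subexponential norm"
  unfolding subexponential_def
proof (intro allI impI)
  fix \<epsilon> :: real assume "0 < \<epsilon>"
  moreover have "\<epsilon> * norm y \<le> exp (\<epsilon> * norm y)" for y :: 'a
    using exp_ge_add_one_self[of "\<epsilon> * norm y"] by linarith
  ultimately show "\<exists>C\<ge>0. \<forall>y::'a. \<bar>norm y\<bar> \<le> C * exp (\<epsilon> * norm y)"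
    by (intro exI[of _ "1 / \<epsilon>"]) (auto simp: field_simps)
qed

lemma subexponential_mult [intro]:
  assumes "subexponential f" "subexponential g"
  shows "subexponential (\<lambda>y. f y * g y)"
  unfolding subexponential_def
proof (intro allI impI)
  fix \<epsilon> :: real assume "0 < \<epsilon>"
  then have "\<epsilon> / 2 > 0" by simp
  then obtain C D where C: "0 \<le> C" "\<And>y. \<bar>f y\<bar> \<le> C * exp (\<epsilon> / 2 * norm y)"
    and D: "0 \<le> D" "\<And>y. \<bar>g y\<bar> \<le> D * exp (\<epsilon> / 2 * norm y)"
    using assms unfolding subexponential_def by blast
  have "\<bar>f y * g y\<bar> \<le> C * D * exp (\<epsilon> * norm y)" for y
  proof -
    have "\<bar>f y * g y\<bar> \<le> (C * exp (\<epsilon> / 2 * norm y)) * (D * exp (\<epsilon> / 2 * norm y))"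
      unfolding abs_mult using C D by (intro mult_mono) auto
    also have "\<dots> = C * D * (exp (\<epsilon> / 2 * norm y) * exp (\<epsilon> / 2 * norm y))"
      by (simp add: algebra_simps)
    also have "\<dots> = C * D * exp (\<epsilon> * norm y)"
      by (simp add: exp_add[symmetric])
    finally show ?thesis .
  qed
  then show "\<exists>C\<ge>0. \<forall>y. \<bar>f y * g y\<bar> \<le> C * exp (\<epsilon> * norm y)"
    using C D by (intro exI[of _ "C * D"]) auto
qed

lemma subexponential_mono:
  assumes "subexponential f" "\<And>y. \<bar>g y\<bar> \<le> \<bar>f y\<bar>"
  shows "subexponential g"
  using assms unfolding subexponential_def by (meson order_trans)

lemma subexponential_inner [simp, intro]: "subexponential (\<lambda>y. y \<bullet> u)"
  by (rule subexponential_mono[OF subexponential_mult[OF subexponential_norm subexponential_const[of "norm u"]]])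
    (simp add: Cauchy_Schwarz_ineq2 abs_mult)

lemma subexponential_nth [simp, intro]: "subexponential (\<lambda>y::real ^ 'n. y $ i)"
  using subexponential_inner[of "axis i 1 :: real ^ 'n"] by (simp add: inner_axis inner_real_def)

section \<open>Exponential moments and differentiation under the integral\<close>

locale natural_exp_family =
  fixes \<nu> :: "(real ^ 'r) measure" and b :: "real ^ 'r \<Rightarrow> real"
  assumes sets_\<nu> [measurable_cong]: "sets \<nu> = sets borel"
    and b [measurable]: "b \<in> borel_measurable borel"
begin

abbreviation dom :: "(real ^ 'r) set" where
  "dom \<equiv> interior (natural_parameter_space \<nu> b)"

text \<open>Left unnormalized: \<open>moment (\<lambda>_. 1)\<close> is the normalizing integral,
  and division by it turns a moment into an expectation under the density at \<theta>.\<close>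

definition moment :: "(real ^ 'r \<Rightarrow> real) \<Rightarrow> real ^ 'r \<Rightarrow> real" where
  "moment g \<theta> = (LINT y|\<nu>. g y * exp (y \<bullet> \<theta> + b y))"

lemma integrable_exp:
  assumes "\<theta> \<in> natural_parameter_space \<nu> b"
  shows "integrable \<nu> (\<lambda>y. exp (y \<bullet> \<theta> + b y))"
  using assms by (intro integrableI_bounded) (auto simp: natural_parameter_space_def)

text \<open>Some basis direction \<open>u\<close> attains the maximum norm of \<open>y\<close>, so
  the extra exponential is absorbed by shifting \<theta> along plus or minus \<open>u\<close>. The
  sum over all these shifts is an integrable majorant because \<theta> is interior.\<close>

lemma integrable_exp_norm:
  assumes "\<theta> \<in> dom"
  shows "\<exists>\<epsilon>>0. integrable \<nu> (\<lambda>y. exp (\<epsilon> * norm y) * exp (y \<bullet> \<theta> + b y))"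
proof -
  obtain e where e: "0 < e" "cball \<theta> e \<subseteq> natural_parameter_space \<nu> b"
    using assms mem_interior_cball by blast
  \<comment> \<open>The square root of the dimension pays for passing from the Euclidean norm to the
    maximum norm.\<close>
  define \<epsilon> where "\<epsilon> = e / sqrt DIM(real ^ 'r)"
  have \<epsilon>: "0 < \<epsilon>"
    using e by (simp add: \<epsilon>_def)
  have "integrable \<nu> (\<lambda>y. \<Sum>u\<in>Basis. exp (y \<bullet> (\<theta> + e *\<^sub>R u) + b y) + exp (y \<bullet> (\<theta> - e *\<^sub>R u) + b y))"
    using e by (intro Bochner_Integration.integrable_sum Bochner_Integration.integrable_add
        integrable_exp) (auto simp: subset_iff dist_norm)
  then have "integrable \<nu> (\<lambda>y. exp (\<epsilon> * norm y) * exp (y \<bullet> \<theta> + b y))"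
  proof (rule Bochner_Integration.integrable_bound)
    show "AE y in \<nu>. norm (exp (\<epsilon> * norm y) * exp (y \<bullet> \<theta> + b y))
      \<le> norm (\<Sum>u\<in>Basis. exp (y \<bullet> (\<theta> + e *\<^sub>R u) + b y) + exp (y \<bullet> (\<theta> - e *\<^sub>R u) + b y))"
    proof (rule AE_I2)
      fix y :: "real ^ 'r"
      have "infnorm y \<in> (\<lambda>u. \<bar>y \<bullet> u\<bar>) ` Basis"
        unfolding infnorm_Max by (rule Max_in) auto
      then obtain u :: "real ^ 'r" where u: "u \<in> Basis" "infnorm y = \<bar>y \<bullet> u\<bar>"
        by auto
      have "\<epsilon> * norm y \<le> \<epsilon> * (sqrt DIM(real ^ 'r) * infnorm y)"
        using \<epsilon> by (intro mult_left_mono norm_le_infnorm) auto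
      also have "\<dots> = e * \<bar>y \<bullet> u\<bar>"
        by (simp add: \<epsilon>_def u)
      finally have "exp (\<epsilon> * norm y) * exp (y \<bullet> \<theta> + b y) \<le> exp (e * \<bar>y \<bullet> u\<bar>) * exp (y \<bullet> \<theta> + b y)"
        by simp
      also have "\<dots> \<le> exp (y \<bullet> (\<theta> + e *\<^sub>R u) + b y) + exp (y \<bullet> (\<theta> - e *\<^sub>R u) + b y)"
        by (cases "0 \<le> y \<bullet> u") (simp_all add: exp_add[symmetric] inner_simps algebra_simps)
      also have "\<dots> \<le> (\<Sum>u\<in>Basis. exp (y \<bullet> (\<theta> + e *\<^sub>R u) + b y) + exp (y \<bullet> (\<theta> - e *\<^sub>R u) + b y))"
        using u by (intro member_le_sum[where f = "\<lambda>u. exp (y \<bullet> (\<theta> + e *\<^sub>R u) + b y) + exp (y \<bullet> (\<theta> - e *\<^sub>R u) + b y)"]) (auto intro: add_nonneg_nonneg)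
      finally show "norm (exp (\<epsilon> * norm y) * exp (y \<bullet> \<theta> + b y))
        \<le> norm (\<Sum>u\<in>Basis. exp (y \<bullet> (\<theta> + e *\<^sub>R u) + b y) + exp (y \<bullet> (\<theta> - e *\<^sub>R u) + b y))"
        by simp
    qed
  qed measurable
  with \<epsilon> show ?thesis by blast
qed

lemma integrable_moment:
  assumes g: "subexponential g" and [measurable]: "g \<in> borel_measurable borel" and "\<theta> \<in> dom"
  shows "integrable \<nu> (\<lambda>y. g y * exp (y \<bullet> \<theta> + b y))"
proof -
  obtain \<epsilon> where \<epsilon>: "\<epsilon> > 0" "integrable \<nu> (\<lambda>y. exp (\<epsilon> * norm y) * exp (y \<bullet> \<theta> + b y))"
    using integrable_exp_norm assms by blast
  obtain C where "0 \<le> C" and C: "\<And>y. \<bar>g y\<bar> \<le> C * exp (\<epsilon> * norm y)"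
    using g \<epsilon> unfolding subexponential_def by blast
  have "integrable \<nu> (\<lambda>y. C * (exp (\<epsilon> * norm y) * exp (y \<bullet> \<theta> + b y)))"
    using \<epsilon> by simp
  then show ?thesis
  proof (rule Bochner_Integration.integrable_bound)
    have "\<bar>g y * exp (y \<bullet> \<theta> + b y)\<bar> \<le> \<bar>C * (exp (\<epsilon> * norm y) * exp (y \<bullet> \<theta> + b y))\<bar>" for y
      using mult_right_mono[OF C[of y], of "exp (y \<bullet> \<theta> + b y)"] \<open>0 \<le> C\<close>
      by (simp add: abs_mult mult.assoc)
    then show "AE y in \<nu>. norm (g y * exp (y \<bullet> \<theta> + b y))
      \<le> norm (C * (exp (\<epsilon> * norm y) * exp (y \<bullet> \<theta> + b y)))"
      by simp
  qed measurable
qed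

text \<open>Differentiation under the integral by a second-order bound: for
  \<open>norm h \<le> \<epsilon> / 2\<close> the remainder of \<open>exp (y \<bullet> h)\<close> is
  at most \<open>(norm y * norm h)\<^sup>2 * exp (\<epsilon> / 2 * norm y)\<close>, so the
  integrated remainder is at most \<open>A * (norm h)\<^sup>2\<close>.\<close>

lemma has_derivative_moment:
  assumes g: "subexponential g" and [measurable]: "g \<in> borel_measurable borel" and \<theta>: "\<theta> \<in> dom"
  shows "(moment g has_derivative (\<lambda>h. moment (\<lambda>y. g y * (y \<bullet> h)) \<theta>)) (at \<theta>)"
proof -
  obtain \<epsilon> where \<epsilon>: "\<epsilon> > 0" "integrable \<nu> (\<lambda>y. exp (\<epsilon> * norm y) * exp (y \<bullet> \<theta> + b y))"
    using integrable_exp_norm \<theta> by blast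
  obtain d where d: "0 < d" "ball \<theta> d \<subseteq> dom"
    using \<theta> open_interior openE by metis
  have "subexponential (\<lambda>y. g y * (norm y * norm y))"
    by (intro subexponential_mult g subexponential_norm)
  then obtain C where C: "\<And>y. \<bar>g y * (norm y * norm y)\<bar> \<le> C * exp (\<epsilon> / 2 * norm y)"
    using \<epsilon> unfolding subexponential_def by (meson half_gt_zero)
  define A where "A = (LINT y|\<nu>. C * (exp (\<epsilon> * norm y) * exp (y \<bullet> \<theta> + b y)))"
  have int: "integrable \<nu> (\<lambda>y. (g y * (y \<bullet> h)) * exp (y \<bullet> \<theta> + b y))" for h
    using g \<theta> by (intro integrable_moment) auto
  have int\<theta>: "integrable \<nu> (\<lambda>y. g y * exp (y \<bullet> \<theta> + b y))" if "\<theta> \<in> dom" for \<theta>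
    using g that by (intro integrable_moment) auto
  show ?thesis
  proof (rule has_derivativeI_sandwich[where e = "min d (\<epsilon> / 2)" and H = "\<lambda>\<eta>. A * norm (\<eta> - \<theta>)"])
    show "0 < min d (\<epsilon> / 2)" using d \<epsilon> by simp
    have "linear (\<lambda>h. moment (\<lambda>y. g y * (y \<bullet> h)) \<theta>)"
    proof (rule linearI)
      fix h k
      show "moment (\<lambda>y. g y * (y \<bullet> (h + k))) \<theta> = moment (\<lambda>y. g y * (y \<bullet> h)) \<theta> + moment (\<lambda>y. g y * (y \<bullet> k)) \<theta>"
        unfolding moment_def
        by (subst Bochner_Integration.integral_add[OF int int, symmetric])
          (simp add: inner_simps algebra_simps)
    next
      fix r h
      show "moment (\<lambda>y. g y * (y \<bullet> (r *\<^sub>R h))) \<theta> = r *\<^sub>R moment (\<lambda>y. g y * (y \<bullet> h)) \<theta>"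
        unfolding moment_def by (simp add: algebra_simps flip: integral_mult_right_zero)
    qed
    then show "bounded_linear (\<lambda>h. moment (\<lambda>y. g y * (y \<bullet> h)) \<theta>)"
      by (simp add: linear_conv_bounded_linear)
    show "((\<lambda>\<eta>. A * norm (\<eta> - \<theta>)) \<longlongrightarrow> 0) (at \<theta>)"
      by (auto intro!: tendsto_eq_intros)
    fix \<eta> assume \<eta>: "\<eta> \<noteq> \<theta>" "dist \<eta> \<theta> < min d (\<epsilon> / 2)"
    define h where "h = \<eta> - \<theta>"
    have h: "h \<noteq> 0" "norm h \<le> \<epsilon> / 2" "\<eta> = \<theta> + h" "\<eta> \<in> dom"
      using \<eta> d by (auto simp: h_def dist_norm norm_minus_commute subset_iff)
    have "moment g \<eta> - moment g \<theta> - moment (\<lambda>y. g y * (y \<bullet> h)) \<theta>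
      = (LINT y|\<nu>. g y * exp (y \<bullet> \<theta> + b y) * (exp (y \<bullet> h) - 1 - y \<bullet> h))"
      unfolding moment_def
      by (simp add: int[of h] int\<theta> h(4) \<theta> flip: Bochner_Integration.integral_diff)
        (simp add: h(3) inner_simps exp_add algebra_simps)
    also have "norm \<dots> \<le> (LINT y|\<nu>. (norm h)\<^sup>2 * (C * (exp (\<epsilon> * norm y) * exp (y \<bullet> \<theta> + b y))))"
    proof (rule Bochner_Integration.integral_norm_bound_integral)
      show "integrable \<nu> (\<lambda>y. (norm h)\<^sup>2 * (C * (exp (\<epsilon> * norm y) * exp (y \<bullet> \<theta> + b y))))"
        using \<epsilon> by simp
      have "integrable \<nu> (\<lambda>y. g y * exp (y \<bullet> \<eta> + b y) - g y * exp (y \<bullet> \<theta> + b y)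
          - (g y * (y \<bullet> h)) * exp (y \<bullet> \<theta> + b y))"
        using int int\<theta> h \<theta> by (intro Bochner_Integration.integrable_diff) auto
      then show "integrable \<nu> (\<lambda>y. g y * exp (y \<bullet> \<theta> + b y) * (exp (y \<bullet> h) - 1 - y \<bullet> h))"
        by (simp add: h(3) inner_simps exp_add algebra_simps)
      fix y :: "real ^ 'r"
      have yh: "\<bar>y \<bullet> h\<bar> \<le> norm y * norm h"
        by (rule Cauchy_Schwarz_ineq2)
      also have "\<dots> \<le> norm y * (\<epsilon> / 2)"
        using h by (intro mult_left_mono) auto
      finally have "exp \<bar>y \<bullet> h\<bar> \<le> exp (\<epsilon> / 2 * norm y)"
        by (simp add: mult.commute)
      moreover have "(y \<bullet> h)\<^sup>2 \<le> (norm y * norm h)\<^sup>2"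
        using yh by (metis abs_ge_zero power2_abs power_mono)
      ultimately have "(y \<bullet> h)\<^sup>2 * exp \<bar>y \<bullet> h\<bar> \<le> (norm y * norm h)\<^sup>2 * exp (\<epsilon> / 2 * norm y)"
        by (intro mult_mono) auto
      with abs_exp_remainder_le[of "y \<bullet> h"]
      have "\<bar>exp (y \<bullet> h) - 1 - y \<bullet> h\<bar> \<le> (norm y * norm h)\<^sup>2 * exp (\<epsilon> / 2 * norm y)"
        by linarith
      then have "\<bar>g y\<bar> * \<bar>exp (y \<bullet> h) - 1 - y \<bullet> h\<bar>
          \<le> \<bar>g y\<bar> * ((norm y * norm h)\<^sup>2 * exp (\<epsilon> / 2 * norm y))"
        by (intro mult_left_mono) auto
      also have "\<dots> = \<bar>g y * (norm y * norm y)\<bar> * ((norm h)\<^sup>2 * exp (\<epsilon> / 2 * norm y))"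
        by (simp add: abs_mult power2_eq_square algebra_simps)
      also have "\<dots> \<le> (C * exp (\<epsilon> / 2 * norm y)) * ((norm h)\<^sup>2 * exp (\<epsilon> / 2 * norm y))"
        by (intro mult_right_mono C) auto
      also have "\<dots> = (norm h)\<^sup>2 * (C * (exp (\<epsilon> / 2 * norm y) * exp (\<epsilon> / 2 * norm y)))"
        by (simp add: algebra_simps)
      also have "\<dots> = (norm h)\<^sup>2 * (C * exp (\<epsilon> * norm y))"
        by (simp add: exp_add[symmetric])
      finally have "\<bar>g y\<bar> * \<bar>exp (y \<bullet> h) - 1 - y \<bullet> h\<bar> * exp (y \<bullet> \<theta> + b y)
          \<le> (norm h)\<^sup>2 * (C * exp (\<epsilon> * norm y)) * exp (y \<bullet> \<theta> + b y)"
        by (intro mult_right_mono) auto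
      then show "norm (g y * exp (y \<bullet> \<theta> + b y) * (exp (y \<bullet> h) - 1 - y \<bullet> h))
        \<le> (norm h)\<^sup>2 * (C * (exp (\<epsilon> * norm y) * exp (y \<bullet> \<theta> + b y)))"
        by (simp add: abs_mult mult_ac)
    qed
    also have "\<dots> = (norm h)\<^sup>2 * A"
      by (simp add: A_def)
    finally show "norm (moment g \<eta> - moment g \<theta> - moment (\<lambda>y. g y * (y \<bullet> (\<eta> - \<theta>))) \<theta>) / norm (\<eta> - \<theta>)
      \<le> A * norm (\<eta> - \<theta>)"
      using h(1) by (simp add: h_def[symmetric] field_simps power2_eq_square)
  qed
qed

lemma moment_one_pos:
  assumes "\<theta> \<in> dom"
  shows "0 < moment (\<lambda>_. 1) \<theta>"
proof -
  have \<theta>: "\<theta> \<in> natural_parameter_space \<nu> b"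
    using assms interior_subset by blast
  have "(\<integral>\<^sup>+ y. ennreal (exp (y \<bullet> \<theta> + b y)) \<partial>\<nu>) = ennreal (moment (\<lambda>_. 1) \<theta>)"
    unfolding moment_def using integrable_exp[OF \<theta>] by (simp add: nn_integral_eq_integral)
  with \<theta> show ?thesis
    by (simp add: natural_parameter_space_def)
qed

section \<open>Gradient and Hessian of the log-partition function\<close>

lemma log_partition_eq: "log_partition \<nu> b \<theta> = ln (moment (\<lambda>_. 1) \<theta>)"
  by (simp add: log_partition_def moment_def)

lemma has_derivative_log_partition_moment:
  assumes "\<theta> \<in> dom"
  shows "(log_partition \<nu> b has_derivative
    (\<lambda>h. moment (\<lambda>y. y \<bullet> h) \<theta> / moment (\<lambda>_. 1) \<theta>)) (at \<theta>)"
proof -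
  have "(moment (\<lambda>_. 1) has_derivative (\<lambda>h. moment (\<lambda>y. y \<bullet> h) \<theta>)) (at \<theta>)"
    using has_derivative_moment[of "\<lambda>_. 1" \<theta>] assms by simp
  then have "((\<lambda>\<theta>. ln (moment (\<lambda>_. 1) \<theta>)) has_derivative
    (\<lambda>h. moment (\<lambda>y. y \<bullet> h) \<theta> * inverse (moment (\<lambda>_. 1) \<theta>))) (at \<theta>)"
    by (rule has_derivative_ln[where g = "moment (\<lambda>_. 1)", OF moment_one_pos[OF assms]])
  then show ?thesis
    by (simp add: log_partition_eq[abs_def] divide_inverse)
qed

text \<open>The right side is the mean of \<open>y \<bullet> h\<close> under the density at
  \<theta>. So the gradient is the mean vector, which is why the score is centred.\<close>

lemma gradient_log_partition_inner:
  assumes "\<theta> \<in> dom"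
  shows "gradient (log_partition \<nu> b) \<theta> \<bullet> h = moment (\<lambda>y. y \<bullet> h) \<theta> / moment (\<lambda>_. 1) \<theta>"
proof -
  define D where "D = (\<lambda>h. moment (\<lambda>y. y \<bullet> h) \<theta> / moment (\<lambda>_. 1) \<theta>)"
  have D: "(log_partition \<nu> b has_derivative D) (at \<theta>)"
    unfolding D_def by (rule has_derivative_log_partition_moment[OF assms])
  then have lin: "linear D"
    by (rule has_derivative_linear)
  have "D h = D (\<Sum>i\<in>UNIV. h $ i *\<^sub>R axis i 1)"
    using basis_expansion[of h] by (simp add: scalar_mult_eq_scaleR)
  also have "\<dots> = (\<Sum>i\<in>UNIV. h $ i *\<^sub>R D (axis i 1))"
    by (simp add: linear_sum[OF lin] linear_scale[OF lin])
  also have "\<dots> = gradient (log_partition \<nu> b) \<theta> \<bullet> h"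
    by (simp add: gradient_def frechet_derivative_at[OF D, symmetric] inner_vec_def mult.commute)
  finally show ?thesis by (simp add: D_def)
qed

lemma has_derivative_log_partition:
  assumes "\<theta> \<in> dom"
  shows "(log_partition \<nu> b has_derivative (\<lambda>h. gradient (log_partition \<nu> b) \<theta> \<bullet> h)) (at \<theta>)"
  using has_derivative_log_partition_moment[OF assms]
  by (simp add: gradient_log_partition_inner[OF assms])

lemma differentiable_moment:
  assumes "subexponential g" "g \<in> borel_measurable borel" "\<theta> \<in> dom"
  shows "moment g differentiable (at \<theta>)"
  using has_derivative_moment[OF assms] by (rule differentiableI)

lemma continuous_on_moment:
  assumes "subexponential g" "g \<in> borel_measurable borel"
  shows "continuous_on dom (moment g)"
  using differentiable_moment[OF assms]
  by (auto simp: continuous_on_eq_continuous_at intro: differentiable_imp_continuous_within)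

text \<open>Quotient rule for the mean of \<open>y $ i\<close>. The formula for the gradient is
  established only on \<open>dom\<close>, so the derivative is transferred on this open set.\<close>

lemma has_derivative_gradient_log_partition_nth:
  assumes "\<theta> \<in> dom"
  shows "((\<lambda>\<theta>. gradient (log_partition \<nu> b) \<theta> $ i) has_derivative
    (\<lambda>h. (moment (\<lambda>y. y $ i * (y \<bullet> h)) \<theta> * moment (\<lambda>_. 1) \<theta>
      - moment (\<lambda>y. y $ i) \<theta> * moment (\<lambda>y. y \<bullet> h) \<theta>) / (moment (\<lambda>_. 1) \<theta> * moment (\<lambda>_. 1) \<theta>))) (at \<theta>)"
proof -
  have eq: "gradient (log_partition \<nu> b) \<eta> $ i = moment (\<lambda>y. y $ i) \<eta> / moment (\<lambda>_. 1) \<eta>"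
    if "\<eta> \<in> dom" for \<eta>
    using gradient_log_partition_inner[OF that, of "axis i 1"] by (simp add: inner_axis inner_real_def)
  have "(moment (\<lambda>y. y $ i) has_derivative (\<lambda>h. moment (\<lambda>y. y $ i * (y \<bullet> h)) \<theta>)) (at \<theta>)"
    using assms by (intro has_derivative_moment) auto
  moreover have "(moment (\<lambda>_. 1) has_derivative (\<lambda>h. moment (\<lambda>y. y \<bullet> h) \<theta>)) (at \<theta>)"
    using has_derivative_moment[of "\<lambda>_. 1" \<theta>] assms by simp
  ultimately have "((\<lambda>\<theta>. moment (\<lambda>y. y $ i) \<theta> / moment (\<lambda>_. 1) \<theta>) has_derivative
    (\<lambda>h. (moment (\<lambda>y. y $ i * (y \<bullet> h)) \<theta> * moment (\<lambda>_. 1) \<theta>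
      - moment (\<lambda>y. y $ i) \<theta> * moment (\<lambda>y. y \<bullet> h) \<theta>) / (moment (\<lambda>_. 1) \<theta> * moment (\<lambda>_. 1) \<theta>))) (at \<theta>)"
    using moment_one_pos[OF assms] by (intro has_derivative_divide') auto
  then show ?thesis
    by (rule has_derivative_transform_within_open[OF _ open_interior assms]) (simp add: eq)
qed

text \<open>The Jacobian matrix represents the derivative once differentiability is known, and
  differentiability follows from that of the components.\<close>

lemma has_derivative_gradient_log_partition:
  assumes "\<theta> \<in> dom"
  shows "(gradient (log_partition \<nu> b) has_derivative (\<lambda>h. hessian (log_partition \<nu> b) \<theta> *v h)) (at \<theta>)"
proof -
  have "gradient (log_partition \<nu> b) differentiable (at \<theta>)"
    using has_derivative_gradient_log_partition_nth[OF assms]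
    by (subst differentiable_componentwise_within)
      (auto simp: Basis_vec_def inner_axis intro!: differentiableI)
  then show ?thesis
    by (simp add: jacobian_works hessian_def)
qed

text \<open>The covariance of \<open>y $ i\<close> and \<open>y $ j\<close>, read off by uniqueness
  of the derivative. In this form the Hessian inherits continuity from the moments.\<close>

lemma hessian_log_partition_nth:
  assumes "\<theta> \<in> dom"
  shows "hessian (log_partition \<nu> b) \<theta> $ i $ j =
    (moment (\<lambda>y. y $ i * y $ j) \<theta> * moment (\<lambda>_. 1) \<theta>
      - moment (\<lambda>y. y $ i) \<theta> * moment (\<lambda>y. y $ j) \<theta>) / (moment (\<lambda>_. 1) \<theta> * moment (\<lambda>_. 1) \<theta>)"
proof -
  have "((\<lambda>\<theta>. gradient (log_partition \<nu> b) \<theta> $ i) has_derivative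
      (\<lambda>h. (hessian (log_partition \<nu> b) \<theta> *v h) $ i)) (at \<theta>)"
    using has_derivative_gradient_log_partition[OF assms]
    by (rule bounded_linear.has_derivative[OF bounded_linear_vec_nth])
  from has_derivative_unique[OF this has_derivative_gradient_log_partition_nth[OF assms]]
  have "(hessian (log_partition \<nu> b) \<theta> *v axis j 1) $ i =
    (moment (\<lambda>y. y $ i * (y \<bullet> axis j 1)) \<theta> * moment (\<lambda>_. 1) \<theta>
      - moment (\<lambda>y. y $ i) \<theta> * moment (\<lambda>y. y \<bullet> axis j 1) \<theta>) / (moment (\<lambda>_. 1) \<theta> * moment (\<lambda>_. 1) \<theta>)"
    by meson
  then show ?thesis
    by (simp add: inner_axis inner_real_def matrix_vector_mul_component)
qed

lemma continuous_on_hessian_log_partition: "continuous_on dom (hessian (log_partition \<nu> b))"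
proof -
  have "continuous_on dom (\<lambda>\<theta>. hessian (log_partition \<nu> b) \<theta> $ i $ j)" for i j
  proof -
    have "continuous_on dom (\<lambda>\<theta>. (moment (\<lambda>y. y $ i * y $ j) \<theta> * moment (\<lambda>_. 1) \<theta>
      - moment (\<lambda>y. y $ i) \<theta> * moment (\<lambda>y. y $ j) \<theta>) / (moment (\<lambda>_. 1) \<theta> * moment (\<lambda>_. 1) \<theta>))"
      using moment_one_pos
      by (intro continuous_intros continuous_on_moment subexponential_mult subexponential_nth subexponential_const)
        (auto, metis less_irrefl)
    then show ?thesis
      by (rule continuous_on_eq) (simp add: hessian_log_partition_nth)
  qed
  then have "continuous_on dom (\<lambda>\<theta>. \<chi> i j. hessian (log_partition \<nu> b) \<theta> $ i $ j)"
    by (intro continuous_on_vec_lambda)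
  then show ?thesis by simp
qed

end

section \<open>Second-order expansion in the regression parameter\<close>

text \<open>The norm of a matrix in this type is the Frobenius norm, so Cauchy-Schwarz in each row
  suffices.\<close>

lemma norm_matrix_vector_le: "norm ((A :: real ^ 'n ^ 'm) *v x) \<le> norm A * norm x"
proof -
  have "norm (A *v x) = L2_set (\<lambda>i. \<bar>A $ i \<bullet> x\<bar>) UNIV"
    by (simp add: norm_vec_def matrix_vector_mul_component)
  also have "\<dots> \<le> L2_set (\<lambda>i. norm x * norm (A $ i)) UNIV"
    using Cauchy_Schwarz_ineq2[of "A $ i" x for i] by (intro L2_set_mono) (simp_all add: mult.commute)
  also have "\<dots> = norm x * norm A"
    by (simp add: L2_set_right_distrib norm_vec_def)
  finally show ?thesis
    by (simp add: mult.commute)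
qed

lemma abs_quadratic_form_le: "\<bar>x \<bullet> ((A :: real ^ 'n ^ 'n) *v x)\<bar> \<le> norm A * (norm x)\<^sup>2"
proof -
  have "\<bar>x \<bullet> (A *v x)\<bar> \<le> norm x * norm (A *v x)"
    by (rule Cauchy_Schwarz_ineq2)
  also have "\<dots> \<le> norm x * (norm A * norm x)"
    by (intro mult_left_mono norm_matrix_vector_le) auto
  finally show ?thesis
    by (simp add: power2_eq_square algebra_simps)
qed

lemma matrix_vector_mult_sum_distrib: "(\<Sum>i\<in>I. A i :: real ^ 'n ^ 'm) *v x = (\<Sum>i\<in>I. A i *v x)"
  by (induction I rule: infinite_finite_induct) (auto simp: matrix_vector_mult_add_rdistrib)

text \<open>The quadratic form attains a positive minimum on the compact unit sphere; homogeneity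
  extends the bound to all vectors.\<close>

lemma positive_definite_lower_bound:
  assumes "positive_definite (J :: real ^ 'n ^ 'n)"
  shows "\<exists>c>0. \<forall>v. c * (norm v)\<^sup>2 \<le> v \<bullet> (J *v v)"
proof -
  have "compact (sphere (0 :: real ^ 'n) 1)" by simp
  moreover have "sphere (0 :: real ^ 'n) 1 \<noteq> {}" by simp
  moreover have "continuous_on (sphere 0 1) (\<lambda>v. v \<bullet> (J *v v))"
    by (intro continuous_intros matrix_vector_mult_linear_continuous_on)
  ultimately obtain u where u: "u \<in> sphere 0 1" "\<And>v. v \<in> sphere 0 1 \<Longrightarrow> u \<bullet> (J *v u) \<le> v \<bullet> (J *v v)"
    using continuous_attains_inf[of "sphere (0 :: real ^ 'n) 1" "\<lambda>v. v \<bullet> (J *v v)"] by auto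
  have "u \<noteq> 0" using u by auto
  then have "0 < u \<bullet> (J *v u)"
    using assms by (simp add: positive_definite_def)
  moreover have "(u \<bullet> (J *v u)) * (norm v)\<^sup>2 \<le> v \<bullet> (J *v v)" for v
  proof (cases "v = 0")
    case False
    define w where "w = v /\<^sub>R norm v"
    have v: "v = norm v *\<^sub>R w"
      using False by (simp add: w_def)
    have "w \<in> sphere 0 1"
      using False by (simp add: w_def)
    then have "(u \<bullet> (J *v u)) * (norm v)\<^sup>2 \<le> (w \<bullet> (J *v w)) * (norm v)\<^sup>2"
      by (intro mult_right_mono u) auto
    also have "\<dots> = v \<bullet> (J *v v)"
      unfolding arg_cong[OF v, of "\<lambda>v. v \<bullet> (J *v v)"]
      by (simp add: matrix_vector_mult_scaleR power2_eq_square)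
    finally show ?thesis .
  qed simp
  ultimately show ?thesis by blast
qed

text \<open>Once \<open>A n\<close> is within \<open>c / 2\<close> of \<open>J\<close> in norm, the
  form changes by at most half of the lower bound for \<open>J\<close>, for all vectors at
  once.\<close>

lemma tendsto_positive_definite:
  fixes A :: "nat \<Rightarrow> real ^ 'n ^ 'n"
  assumes lim: "A \<longlonglongrightarrow> J" and J: "positive_definite J"
  shows "\<exists>c>0. \<exists>C\<ge>0. \<forall>\<^sub>F n in sequentially. \<forall>v.
    c * (norm v)\<^sup>2 \<le> v \<bullet> (A n *v v) \<and> v \<bullet> (A n *v v) \<le> C * (norm v)\<^sup>2"
proof -
  obtain c where c: "0 < c" "\<And>v. c * (norm v)\<^sup>2 \<le> v \<bullet> (J *v v)"
    using positive_definite_lower_bound[OF J] by blast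
  have "\<forall>\<^sub>F n in sequentially. norm (A n - J) < c / 2"
    using lim c tendstoD[of A J sequentially "c / 2"] by (simp add: dist_norm)
  then have "\<forall>\<^sub>F n in sequentially. \<forall>v.
    c / 2 * (norm v)\<^sup>2 \<le> v \<bullet> (A n *v v) \<and> v \<bullet> (A n *v v) \<le> (norm J + c / 2) * (norm v)\<^sup>2"
  proof eventually_elim
    case (elim n)
    show ?case
    proof
      fix v :: "real ^ 'n"
      have eq: "v \<bullet> (A n *v v) = v \<bullet> (J *v v) + v \<bullet> ((A n - J) *v v)"
        by (simp add: matrix_vector_mult_diff_rdistrib inner_diff_right)
      have "\<bar>v \<bullet> ((A n - J) *v v)\<bar> \<le> norm (A n - J) * (norm v)\<^sup>2"
        by (rule abs_quadratic_form_le)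
      also have "\<dots> \<le> c / 2 * (norm v)\<^sup>2"
        using elim by (intro mult_right_mono) auto
      finally show "c / 2 * (norm v)\<^sup>2 \<le> v \<bullet> (A n *v v) \<and> v \<bullet> (A n *v v) \<le> (norm J + c / 2) * (norm v)\<^sup>2"
        using c(2)[of v] abs_quadratic_form_le[of v J]
        unfolding eq abs_le_iff distrib_right by linarith
    qed
  qed
  then show ?thesis
    using c by (intro exI[of _ "c / 2"] conjI exI[of _ "norm J + c / 2"]) auto
qed

text \<open>The affine minorant based at the intermediate point \<open>z\<close> is evaluated at
  both endpoints; in the convex combination the linear parts cancel.\<close>

lemma convex_on_of_affine_minorants:
  fixes f :: "'a::real_vector \<Rightarrow> real"
  assumes "convex S" and lin: "\<And>x. x \<in> S \<Longrightarrow> linear (D x)"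
    and minorant: "\<And>x y. x \<in> S \<Longrightarrow> y \<in> S \<Longrightarrow> f x + D x (y - x) \<le> f y"
  shows "convex_on S f"
proof (rule convex_onI[OF _ \<open>convex S\<close>])
  fix t :: real and x y :: 'a
  assume t: "0 < t" "t < 1" and xy: "x \<in> S" "y \<in> S"
  define z where "z = (1 - t) *\<^sub>R x + t *\<^sub>R y"
  have z: "z \<in> S"
    unfolding z_def using t xy \<open>convex S\<close> by (intro convexD_alt) auto
  have "x - z = (- t) *\<^sub>R (y - x)" "y - z = (1 - t) *\<^sub>R (y - x)"
    by (simp_all add: z_def algebra_simps)
  then have "D z (x - z) = - t * D z (y - x)" "D z (y - z) = (1 - t) * D z (y - x)"
    using linear_scale[OF lin[OF z]] by (metis real_scaleR_def)+
  with minorant[OF z xy(1)] minorant[OF z xy(2)]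
  have "(1 - t) * (f z - t * D z (y - x)) \<le> (1 - t) * f x"
    "t * (f z + (1 - t) * D z (y - x)) \<le> t * f y"
    using t by (auto intro!: mult_left_mono)
  then show "f ((1 - t) *\<^sub>R x + t *\<^sub>R y) \<le> (1 - t) * f x + t * f y"
    unfolding z_def[symmetric] by (simp add: algebra_simps)
qed

lemma continuous_on_matrix_vector_mult [continuous_intros]:
  fixes f :: "'a::topological_space \<Rightarrow> real ^ 'n ^ 'm"
  assumes "continuous_on S f" "continuous_on S g"
  shows "continuous_on S (\<lambda>x. f x *v g x)"
  unfolding matrix_vector_mult_def using assms by (intro continuous_intros)

section \<open>Taylor expansion, convexity and uniform quadratic approximation\<close>

context natural_exp_family
begin

text \<open>One-dimensional Taylor expansion along the segment from \<theta> to
  \<open>\<theta> + h\<close>. The evaluation point of the Hessian is the Lagrange intermediate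
  point.\<close>

lemma log_partition_taylor:
  assumes seg: "\<And>t. 0 \<le> t \<Longrightarrow> t \<le> 1 \<Longrightarrow> \<theta> + t *\<^sub>R h \<in> dom"
  shows "\<exists>t. 0 < t \<and> t < 1 \<and> log_partition \<nu> b (\<theta> + h) =
    log_partition \<nu> b \<theta> + gradient (log_partition \<nu> b) \<theta> \<bullet> h
      + h \<bullet> (hessian (log_partition \<nu> b) (\<theta> + t *\<^sub>R h) *v h) / 2"
proof -
  let ?a = "log_partition \<nu> b"
  \<comment> \<open>The function on the segment and its first two derivatives, indexed by order;
    values at orders above 2 are irrelevant.\<close>
  define f where "f = (\<lambda>m::nat. if m = 0 then (\<lambda>t. ?a (\<theta> + t *\<^sub>R h))
    else if m = 1 then (\<lambda>t. gradient ?a (\<theta> + t *\<^sub>R h) \<bullet> h)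
    else (\<lambda>t. h \<bullet> (hessian ?a (\<theta> + t *\<^sub>R h) *v h)))"
  have line: "((\<lambda>t. \<theta> + t *\<^sub>R h) has_derivative (\<lambda>s. s *\<^sub>R h)) (at t)" for t
    by (auto intro!: derivative_eq_intros)
  have "DERIV (f m) t :> f (Suc m) t" if "m < 2" "0 \<le> t" "t \<le> 1" for m t
  proof -
    have t: "\<theta> + t *\<^sub>R h \<in> dom"
      using seg that by blast
    have "((\<lambda>t. ?a (\<theta> + t *\<^sub>R h)) has_derivative (\<lambda>s. gradient ?a (\<theta> + t *\<^sub>R h) \<bullet> (s *\<^sub>R h))) (at t)"
      using has_derivative_compose[OF line has_derivative_log_partition[OF t]] .
    moreover have "((\<lambda>t. gradient ?a (\<theta> + t *\<^sub>R h)) has_derivative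
        (\<lambda>s. hessian ?a (\<theta> + t *\<^sub>R h) *v (s *\<^sub>R h))) (at t)"
      using has_derivative_compose[OF line has_derivative_gradient_log_partition[OF t]] .
    then have "((\<lambda>t. gradient ?a (\<theta> + t *\<^sub>R h) \<bullet> h) has_derivative
        (\<lambda>s. (hessian ?a (\<theta> + t *\<^sub>R h) *v (s *\<^sub>R h)) \<bullet> h)) (at t)"
      by (rule has_derivative_inner_left)
    moreover have "m = 0 \<or> m = 1"
      using that by auto
    ultimately show ?thesis
      by (auto simp: f_def has_field_derivative_def matrix_vector_mult_scaleR inner_commute mult.commute
          elim!: has_derivative_eq_rhs)
  qed
  then obtain t where "0 < t" "t < 1"
    "f 0 1 = (\<Sum>m<2. f m 0 / fact m * (1 - 0) ^ m) + f 2 t / fact 2 * (1 - 0)\<^sup>2"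
    using Taylor_up[of 2 f "f 0" 0 1 0] by auto
  then show ?thesis
    by (intro exI[of _ t]) (simp add: f_def numeral_2_eq_2)
qed

text \<open>The linear map \<open>Z\<close> carries the segment between \<beta> and
  \<open>\<beta>'\<close>, which stays in the convex set \<open>B\<close>, to a segment inside
  \<open>dom\<close>.\<close>

lemma log_partition_regression_taylor:
  assumes "convex B" and dom: "\<And>\<beta>. \<beta> \<in> B \<Longrightarrow> Z *v \<beta> \<in> dom" and \<beta>: "\<beta> \<in> B" "\<beta>' \<in> B"
  shows "\<exists>t. 0 < t \<and> t < 1 \<and> log_partition \<nu> b (Z *v \<beta>') =
    log_partition \<nu> b (Z *v \<beta>) + gradient (log_partition \<nu> b) (Z *v \<beta>) \<bullet> (Z *v (\<beta>' - \<beta>))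
      + (Z *v (\<beta>' - \<beta>)) \<bullet> (hessian (log_partition \<nu> b) (Z *v (\<beta> + t *\<^sub>R (\<beta>' - \<beta>))) *v (Z *v (\<beta>' - \<beta>))) / 2"
proof -
  have "Z *v \<beta> + t *\<^sub>R (Z *v (\<beta>' - \<beta>)) \<in> dom" if "0 \<le> t" "t \<le> 1" for t
  proof -
    have "(1 - t) *\<^sub>R \<beta> + t *\<^sub>R \<beta>' \<in> B"
      using assms that by (intro convexD_alt) auto
    then have "Z *v (\<beta> + t *\<^sub>R (\<beta>' - \<beta>)) \<in> dom"
      by (intro dom) (simp add: algebra_simps)
    then show ?thesis
      by (simp add: matrix_vector_right_distrib matrix_vector_mult_scaleR)
  qed
  from log_partition_taylor[OF this] show ?thesis
    by (simp add: matrix_vector_right_distrib[symmetric] matrix_vector_mult_scaleR[symmetric])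
qed

text \<open>The second-order term of the expansion is nonnegative, so each first-order expansion is
  an affine minorant on all of \<open>B\<close>.\<close>

lemma convex_on_log_partition_regression:
  assumes "convex B" and dom: "\<And>\<beta>. \<beta> \<in> B \<Longrightarrow> Z *v \<beta> \<in> dom"
    and pd: "\<And>\<theta>. \<theta> \<in> dom \<Longrightarrow> positive_definite (hessian (log_partition \<nu> b) \<theta>)"
  shows "convex_on B (\<lambda>\<beta>. log_partition \<nu> b (Z *v \<beta>))"
proof (rule convex_on_of_affine_minorants[OF \<open>convex B\<close>,
    where D = "\<lambda>\<beta> h. gradient (log_partition \<nu> b) (Z *v \<beta>) \<bullet> (Z *v h)"])
  show "linear (\<lambda>h. gradient (log_partition \<nu> b) (Z *v \<beta>) \<bullet> (Z *v h))" for \<beta>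
    by (rule linearI) (simp_all add: matrix_vector_right_distrib matrix_vector_mult_scaleR inner_add_right)
next
  fix \<beta> \<beta>' assume \<beta>: "\<beta> \<in> B" "\<beta>' \<in> B"
  obtain t where t: "0 < t" "t < 1" "log_partition \<nu> b (Z *v \<beta>') =
    log_partition \<nu> b (Z *v \<beta>) + gradient (log_partition \<nu> b) (Z *v \<beta>) \<bullet> (Z *v (\<beta>' - \<beta>))
      + (Z *v (\<beta>' - \<beta>)) \<bullet> (hessian (log_partition \<nu> b) (Z *v (\<beta> + t *\<^sub>R (\<beta>' - \<beta>))) *v (Z *v (\<beta>' - \<beta>))) / 2"
    using log_partition_regression_taylor[OF assms(1,2) \<beta>] by blast
  have "(1 - t) *\<^sub>R \<beta> + t *\<^sub>R \<beta>' \<in> B"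
    using assms \<beta> t by (intro convexD_alt) auto
  then have "Z *v (\<beta> + t *\<^sub>R (\<beta>' - \<beta>)) \<in> dom"
    by (intro dom) (simp add: algebra_simps)
  then have "positive_definite (hessian (log_partition \<nu> b) (Z *v (\<beta> + t *\<^sub>R (\<beta>' - \<beta>))))"
    by (rule pd)
  \<comment> \<open>\<open>Z\<close> may map the difference to 0, a case that positive definiteness
    does not address; the form then vanishes.\<close>
  then have "0 \<le> (Z *v (\<beta>' - \<beta>)) \<bullet>
      (hessian (log_partition \<nu> b) (Z *v (\<beta> + t *\<^sub>R (\<beta>' - \<beta>))) *v (Z *v (\<beta>' - \<beta>)))"
    unfolding positive_definite_def by (cases "Z *v (\<beta>' - \<beta>) = 0") (auto intro: less_imp_le)
  then show "log_partition \<nu> b (Z *v \<beta>) + gradient (log_partition \<nu> b) (Z *v \<beta>) \<bullet> (Z *v (\<beta>' - \<beta>))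
      \<le> log_partition \<nu> b (Z *v \<beta>')"
    unfolding t(3) by simp
qed

text \<open>The Hessian at \<open>Z *v \<beta>\<close> is uniformly continuous in
  \<open>(Z, \<beta>)\<close> on a compact product. Replacing the intermediate point of the Taylor
  formula by \<open>\<beta>\<^sub>0\<close> therefore costs little, with one radius
  \<open>\<delta>\<close> for all regressors.\<close>

lemma log_partition_uniform_quadratic:
  assumes "compact \<X>" "open B" "\<beta>\<^sub>0 \<in> B" "0 < \<epsilon>"
    and dom: "\<And>Z \<beta>. Z \<in> \<X> \<Longrightarrow> \<beta> \<in> B \<Longrightarrow> Z *v \<beta> \<in> dom"
  shows "\<exists>\<delta>>0. cball \<beta>\<^sub>0 \<delta> \<subseteq> B \<and> (\<forall>Z\<in>\<X>. \<forall>\<beta>\<in>cball \<beta>\<^sub>0 \<delta>.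
    \<bar>log_partition \<nu> b (Z *v \<beta>) - log_partition \<nu> b (Z *v \<beta>\<^sub>0)
      - gradient (log_partition \<nu> b) (Z *v \<beta>\<^sub>0) \<bullet> (Z *v (\<beta> - \<beta>\<^sub>0))
      - (\<beta> - \<beta>\<^sub>0) \<bullet> (information \<nu> b \<beta>\<^sub>0 Z *v (\<beta> - \<beta>\<^sub>0)) / 2\<bar> \<le> \<epsilon> * (norm (\<beta> - \<beta>\<^sub>0))\<^sup>2)"
proof -
  let ?H = "hessian (log_partition \<nu> b)"
  obtain \<rho> where \<rho>: "0 < \<rho>" "cball \<beta>\<^sub>0 \<rho> \<subseteq> B"
    using assms open_contains_cball by metis
  obtain R where R: "0 < R" "\<And>Z. Z \<in> \<X> \<Longrightarrow> norm Z \<le> R"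
    using compact_imp_bounded[OF \<open>compact \<X>\<close>] bounded_pos by metis
  have "continuous_on (\<X> \<times> cball \<beta>\<^sub>0 \<rho>) (\<lambda>p. ?H (fst p *v snd p))"
    using \<rho> dom
    by (intro continuous_on_compose2[OF continuous_on_hessian_log_partition] continuous_intros) auto
  then have "uniformly_continuous_on (\<X> \<times> cball \<beta>\<^sub>0 \<rho>) (\<lambda>p. ?H (fst p *v snd p))"
    using assms by (intro compact_uniformly_continuous compact_Times) auto
  \<comment> \<open>The tolerance for the Hessian is divided by \<open>R\<^sup>2\<close> because
    \<open>norm (Z *v h)\<close> can be as large as \<open>R * norm h\<close>.\<close>
  moreover have "0 < \<epsilon> / R\<^sup>2"
    using assms R by simp
  ultimately obtain \<eta> where \<eta>: "0 < \<eta>"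
    "\<And>p q. p \<in> \<X> \<times> cball \<beta>\<^sub>0 \<rho> \<Longrightarrow> q \<in> \<X> \<times> cball \<beta>\<^sub>0 \<rho> \<Longrightarrow> dist q p < \<eta> \<Longrightarrow>
      dist (?H (fst q *v snd q)) (?H (fst p *v snd p)) < \<epsilon> / R\<^sup>2"
    unfolding uniformly_continuous_on_def by metis
  define \<delta> where "\<delta> = min \<rho> (\<eta> / 2)"
  have \<delta>: "0 < \<delta>" "\<delta> \<le> \<rho>" "\<delta> < \<eta>"
    using \<rho> \<eta> by (auto simp: \<delta>_def)
  have "cball \<beta>\<^sub>0 \<delta> \<subseteq> B"
    using \<rho> \<delta> by auto
  moreover have "\<bar>log_partition \<nu> b (Z *v \<beta>) - log_partition \<nu> b (Z *v \<beta>\<^sub>0)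
      - gradient (log_partition \<nu> b) (Z *v \<beta>\<^sub>0) \<bullet> (Z *v (\<beta> - \<beta>\<^sub>0))
      - (\<beta> - \<beta>\<^sub>0) \<bullet> (information \<nu> b \<beta>\<^sub>0 Z *v (\<beta> - \<beta>\<^sub>0)) / 2\<bar> \<le> \<epsilon> * (norm (\<beta> - \<beta>\<^sub>0))\<^sup>2"
    if Z: "Z \<in> \<X>" and \<beta>: "\<beta> \<in> cball \<beta>\<^sub>0 \<delta>" for Z \<beta>
  proof -
    define h where "h = \<beta> - \<beta>\<^sub>0"
    have h: "norm h \<le> \<delta>"
      using \<beta> by (simp add: h_def dist_norm norm_minus_commute)
    have "\<beta>\<^sub>0 \<in> cball \<beta>\<^sub>0 \<delta>"
      using \<delta> by simp
    then obtain t where t: "0 < t" "t < 1" "log_partition \<nu> b (Z *v \<beta>) =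
        log_partition \<nu> b (Z *v \<beta>\<^sub>0) + gradient (log_partition \<nu> b) (Z *v \<beta>\<^sub>0) \<bullet> (Z *v h)
          + (Z *v h) \<bullet> (?H (Z *v (\<beta>\<^sub>0 + t *\<^sub>R h)) *v (Z *v h)) / 2"
      using log_partition_regression_taylor[of "cball \<beta>\<^sub>0 \<delta>" Z \<beta>\<^sub>0 \<beta>] dom[OF Z] \<open>cball \<beta>\<^sub>0 \<delta> \<subseteq> B\<close> \<beta>
      unfolding h_def by blast
    have th: "norm (t *\<^sub>R h) \<le> \<delta>"
      using t h mult_mono[of t 1 "norm h" \<delta>] by simp
    have "dist (?H (Z *v (\<beta>\<^sub>0 + t *\<^sub>R h))) (?H (Z *v \<beta>\<^sub>0)) < \<epsilon> / R\<^sup>2"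
      using \<eta>(2)[of "(Z, \<beta>\<^sub>0)" "(Z, \<beta>\<^sub>0 + t *\<^sub>R h)"] th \<delta> \<rho> Z by (simp add: dist_Pair_Pair dist_norm)
    then have D: "norm (?H (Z *v (\<beta>\<^sub>0 + t *\<^sub>R h)) - ?H (Z *v \<beta>\<^sub>0)) \<le> \<epsilon> / R\<^sup>2"
      by (simp add: dist_norm)
    have "norm (Z *v h) \<le> norm Z * norm h"
      by (rule norm_matrix_vector_le)
    also have "\<dots> \<le> R * norm h"
      using R Z by (intro mult_right_mono) auto
    finally have Zh: "(norm (Z *v h))\<^sup>2 \<le> R\<^sup>2 * (norm h)\<^sup>2"
      by (metis norm_ge_zero power_mono power_mult_distrib)
    have info: "h \<bullet> (information \<nu> b \<beta>\<^sub>0 Z *v h) = (Z *v h) \<bullet> (?H (Z *v \<beta>\<^sub>0) *v (Z *v h))"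
      unfolding information_def matrix_vector_mul_assoc[symmetric] transpose_matrix_vector
      by (simp add: inner_commute[of h] dot_lmul_matrix) (simp add: inner_commute)
    have "\<bar>(Z *v h) \<bullet> ((?H (Z *v (\<beta>\<^sub>0 + t *\<^sub>R h)) - ?H (Z *v \<beta>\<^sub>0)) *v (Z *v h))\<bar>
        \<le> norm (?H (Z *v (\<beta>\<^sub>0 + t *\<^sub>R h)) - ?H (Z *v \<beta>\<^sub>0)) * (norm (Z *v h))\<^sup>2"
      by (rule abs_quadratic_form_le)
    also have "\<dots> \<le> \<epsilon> / R\<^sup>2 * (R\<^sup>2 * (norm h)\<^sup>2)"
      using D Zh \<open>0 < \<epsilon> / R\<^sup>2\<close> by (intro mult_mono) auto
    also have "\<dots> = \<epsilon> * (norm h)\<^sup>2"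
      using R by simp
    finally have "\<bar>(Z *v h) \<bullet> (?H (Z *v (\<beta>\<^sub>0 + t *\<^sub>R h)) *v (Z *v h))
        - h \<bullet> (information \<nu> b \<beta>\<^sub>0 Z *v h)\<bar> \<le> \<epsilon> * (norm h)\<^sup>2"
      by (simp add: info matrix_vector_mult_diff_rdistrib inner_diff_right)
    then show ?thesis
      unfolding h_def[symmetric] t(3) by (simp add: abs_le_iff)
  qed
  ultimately show ?thesis
    using \<delta> by blast
qed

end

section \<open>Tightness of the score\<close>

text \<open>On expanding the square, each off-diagonal product has expectation equal to a product of
  zero means.\<close>

lemma (in prob_space) expectation_square_sum_indep:
  fixes X :: "'i \<Rightarrow> 'a \<Rightarrow> real"
  assumes "finite I" and indep: "indep_vars (\<lambda>_. borel) X I"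
    and int: "\<And>i. i \<in> I \<Longrightarrow> integrable M (X i)" "\<And>i. i \<in> I \<Longrightarrow> integrable M (\<lambda>\<omega>. (X i \<omega>)\<^sup>2)"
    and mean: "\<And>i. i \<in> I \<Longrightarrow> expectation (X i) = 0"
  shows "integrable M (\<lambda>\<omega>. (\<Sum>i\<in>I. X i \<omega>)\<^sup>2)"
    and "expectation (\<lambda>\<omega>. (\<Sum>i\<in>I. X i \<omega>)\<^sup>2) = (\<Sum>i\<in>I. expectation (\<lambda>\<omega>. (X i \<omega>)\<^sup>2))"
proof -
  have prod: "integrable M (\<lambda>\<omega>. X i \<omega> * X j \<omega>) \<and>
      expectation (\<lambda>\<omega>. X i \<omega> * X j \<omega>) = (if i = j then expectation (\<lambda>\<omega>. (X i \<omega>)\<^sup>2) else 0)"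
    if "i \<in> I" "j \<in> I" for i j
  proof (cases "i = j")
    case True
    then show ?thesis
      using int(2)[OF that(1)] by (simp add: power2_eq_square)
  next
    case False
    have "indep_var borel (X i) borel (X j)"
      \<comment> \<open>Independence of a pair comes from independence of \<open>X i\<close> and a
        sum over the singleton \<open>{j}\<close>.\<close>
      using indep_vars_sum[of "{j}" i X] indep_vars_subset[OF indep, of "{i, j}"] that False by simp
    from indep_var_integrable[OF this] indep_var_lebesgue_integral[OF this] show ?thesis
      using int(1) mean that False by simp
  qed
  have eq: "(\<Sum>i\<in>I. X i \<omega>)\<^sup>2 = (\<Sum>i\<in>I. \<Sum>j\<in>I. X i \<omega> * X j \<omega>)" for \<omega>
    by (simp add: power2_eq_square sum_product)
  show "integrable M (\<lambda>\<omega>. (\<Sum>i\<in>I. X i \<omega>)\<^sup>2)"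
    unfolding eq using prod by (intro Bochner_Integration.integrable_sum) auto
  have "expectation (\<lambda>\<omega>. (\<Sum>i\<in>I. X i \<omega>)\<^sup>2)
      = (\<Sum>i\<in>I. \<Sum>j\<in>I. if i = j then expectation (\<lambda>\<omega>. (X i \<omega>)\<^sup>2) else 0)"
    unfolding eq using prod by (simp add: Bochner_Integration.integral_sum)
  then show "expectation (\<lambda>\<omega>. (\<Sum>i\<in>I. X i \<omega>)\<^sup>2) = (\<Sum>i\<in>I. expectation (\<lambda>\<omega>. (X i \<omega>)\<^sup>2))"
    using \<open>finite I\<close> by simp
qed

section \<open>Moments of the residuals and of the score\<close>

context natural_exp_family
begin

text \<open>The density times \<open>g\<close> is the integrand of \<open>moment g\<close> divided
  by the normalizing integral, so expectations are quotients of moments.\<close>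

lemma expectation_nef:
  assumes Y: "distributed M \<nu> Y (\<lambda>v. ennreal (nef_density \<nu> b \<theta> v))" and \<theta>: "\<theta> \<in> dom"
    and g: "subexponential g" "g \<in> borel_measurable borel"
  shows "integrable M (\<lambda>\<omega>. g (Y \<omega>))"
    and "(LINT \<omega>|M. g (Y \<omega>)) = moment g \<theta> / moment (\<lambda>_. 1) \<theta>"
proof -
  have eq: "nef_density \<nu> b \<theta> v * g v = g v * exp (v \<bullet> \<theta> + b v) / moment (\<lambda>_. 1) \<theta>" for v
    using moment_one_pos[OF \<theta>]
    by (simp add: nef_density_def log_partition_eq exp_add exp_diff)
  have nonneg: "0 \<le> nef_density \<nu> b \<theta> v" for v
    by (simp add: nef_density_def)
  have gm: "g \<in> borel_measurable \<nu>"
    using g(2) sets_\<nu> by simp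
  show "integrable M (\<lambda>\<omega>. g (Y \<omega>))"
    using distributed_integrable[OF Y gm nonneg] integrable_moment[OF g \<theta>] by (simp add: eq)
  show "(LINT \<omega>|M. g (Y \<omega>)) = moment g \<theta> / moment (\<lambda>_. 1) \<theta>"
    using distributed_integral[OF Y gm nonneg] by (simp add: eq moment_def)
qed

text \<open>Centring uses that the gradient is the mean. The variance is at most the raw second
  moment, which Cauchy-Schwarz bounds by a continuous function of \<theta>; this allows a bound
  uniform over compact sets of regressors.\<close>

lemma centered_projection:
  assumes "prob_space M" and Y: "distributed M \<nu> Y (\<lambda>v. ennreal (nef_density \<nu> b \<theta> v))" and \<theta>: "\<theta> \<in> dom"
  defines "m \<equiv> gradient (log_partition \<nu> b) \<theta>"
  shows "integrable M (\<lambda>\<omega>. (Y \<omega> - m) \<bullet> u)"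
    and "(LINT \<omega>|M. (Y \<omega> - m) \<bullet> u) = 0"
    and "integrable M (\<lambda>\<omega>. ((Y \<omega> - m) \<bullet> u)\<^sup>2)"
    and "(LINT \<omega>|M. ((Y \<omega> - m) \<bullet> u)\<^sup>2) \<le> (norm u)\<^sup>2 * (moment (\<lambda>y. norm y * norm y) \<theta> / moment (\<lambda>_. 1) \<theta>)"
proof -
  interpret prob_space M by fact
  have lin: "integrable M (\<lambda>\<omega>. Y \<omega> \<bullet> u)" "expectation (\<lambda>\<omega>. Y \<omega> \<bullet> u) = m \<bullet> u"
    using expectation_nef[OF Y \<theta>, of "\<lambda>y. y \<bullet> u"] gradient_log_partition_inner[OF \<theta>]
    by (auto simp: m_def)
  have sq: "integrable M (\<lambda>\<omega>. (Y \<omega> \<bullet> u)\<^sup>2)"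
    unfolding power2_eq_square by (rule expectation_nef(1)[OF Y \<theta> subexponential_mult]) auto
  have n2: "integrable M (\<lambda>\<omega>. norm (Y \<omega>) * norm (Y \<omega>))"
    "expectation (\<lambda>\<omega>. norm (Y \<omega>) * norm (Y \<omega>)) = moment (\<lambda>y. norm y * norm y) \<theta> / moment (\<lambda>_. 1) \<theta>"
    using expectation_nef[OF Y \<theta> subexponential_mult[OF subexponential_norm subexponential_norm]] by auto
  show "integrable M (\<lambda>\<omega>. (Y \<omega> - m) \<bullet> u)" "expectation (\<lambda>\<omega>. (Y \<omega> - m) \<bullet> u) = 0"
    using lin by (simp_all add: inner_diff_left prob_space)
  have eq: "((Y \<omega> - m) \<bullet> u)\<^sup>2 = (Y \<omega> \<bullet> u)\<^sup>2 - 2 * (m \<bullet> u) * (Y \<omega> \<bullet> u) + (m \<bullet> u)\<^sup>2" for \<omega>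
    by (simp add: inner_diff_left power2_eq_square algebra_simps)
  show "integrable M (\<lambda>\<omega>. ((Y \<omega> - m) \<bullet> u)\<^sup>2)"
    unfolding eq using lin sq by simp
  have "expectation (\<lambda>\<omega>. ((Y \<omega> - m) \<bullet> u)\<^sup>2) = expectation (\<lambda>\<omega>. (Y \<omega> \<bullet> u)\<^sup>2) - (m \<bullet> u)\<^sup>2"
    unfolding eq using lin sq by (simp add: prob_space power2_eq_square)
  also have "\<dots> \<le> expectation (\<lambda>\<omega>. (Y \<omega> \<bullet> u)\<^sup>2)"
    by simp
  also have "\<dots> \<le> expectation (\<lambda>\<omega>. (norm u)\<^sup>2 * (norm (Y \<omega>) * norm (Y \<omega>)))"
  proof (intro integral_mono sq)
    fix \<omega>
    have "(Y \<omega> \<bullet> u)\<^sup>2 \<le> (norm (Y \<omega>) * norm u)\<^sup>2"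
      using Cauchy_Schwarz_ineq2[of "Y \<omega>" u] by (metis abs_ge_zero power2_abs power_mono)
    then show "(Y \<omega> \<bullet> u)\<^sup>2 \<le> (norm u)\<^sup>2 * (norm (Y \<omega>) * norm (Y \<omega>))"
      by (simp add: power2_eq_square algebra_simps)
  qed (use n2 in simp)
  finally show "expectation (\<lambda>\<omega>. ((Y \<omega> - m) \<bullet> u)\<^sup>2)
      \<le> (norm u)\<^sup>2 * (moment (\<lambda>y. norm y * norm y) \<theta> / moment (\<lambda>_. 1) \<theta>)"
    by (simp add: n2(2))
qed

text \<open>The gradient in \<beta> of the log-likelihood of the first \<open>n\<close>
  observations; multiplying by a row vector from the left replaces the transpose of
  \<open>X i\<close>.\<close>

definition score :: "(nat \<Rightarrow> real ^ 'p ^ 'r) \<Rightarrow> (nat \<Rightarrow> real ^ 'r) \<Rightarrow> real ^ 'p \<Rightarrow> nat \<Rightarrow> real ^ 'p" where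
  "score X y \<beta> n = (\<Sum>i=1..n. (y i - gradient (log_partition \<nu> b) (X i *v \<beta>)) v* X i)"

lemma inner_score:
  "score X y \<beta> n \<bullet> h = (\<Sum>i=1..n. (y i - gradient (log_partition \<nu> b) (X i *v \<beta>)) \<bullet> (X i *v h))"
  by (simp add: score_def inner_sum_left dot_lmul_matrix)

lemma measurable_score:
  fixes X :: "nat \<Rightarrow> real ^ 'p ^ 'r"
  assumes "\<And>i. 1 \<le> i \<Longrightarrow> y i \<in> borel_measurable M"
  shows "(\<lambda>\<omega>. score X (\<lambda>i. y i \<omega>) \<beta> n) \<in> borel_measurable M"
proof (rule borel_measurable_euclidean_space[THEN iffD2], intro ballI)
  fix u :: "real ^ 'p"
  have "(\<lambda>\<omega>. (y i \<omega> - gradient (log_partition \<nu> b) (X i *v \<beta>)) \<bullet> (X i *v u)) \<in> borel_measurable M"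
    if "i \<in> {1..n}" for i
    using that
    by (intro borel_measurable_inner borel_measurable_diff borel_measurable_const assms) auto
  then show "(\<lambda>\<omega>. score X (\<lambda>i. y i \<omega>) \<beta> n \<bullet> u) \<in> borel_measurable M"
    unfolding inner_score by (rule borel_measurable_sum)
qed

text \<open>Each coordinate of the score is a sum of independent centred terms with uniformly
  bounded variances. Hence its squared norm has expectation of order \<open>n\<close>, and Markov's
  inequality applies.\<close>

lemma score_tight:
  fixes X :: "nat \<Rightarrow> real ^ 'p ^ 'r"
  assumes "prob_space M" and "compact \<X>" and X: "\<And>i. 1 \<le> i \<Longrightarrow> X i \<in> \<X>"
    and dom: "\<And>Z. Z \<in> \<X> \<Longrightarrow> Z *v \<beta> \<in> dom"
    and indep: "prob_space.indep_vars M (\<lambda>_. borel) y {1..}"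
    and density: "\<And>i. 1 \<le> i \<Longrightarrow> distributed M \<nu> (y i) (\<lambda>v. ennreal (nef_density \<nu> b (X i *v \<beta>) v))"
    and "0 < \<epsilon>"
  shows "\<exists>K\<ge>0. \<forall>n\<ge>1. \<P>(\<omega> in M. K * sqrt (real n) < norm (score X (\<lambda>i. y i \<omega>) \<beta> n)) \<le> \<epsilon>"
proof -
  interpret prob_space M by fact
  let ?U = "\<lambda>n \<omega>. score X (\<lambda>i. y i \<omega>) \<beta> n"
  let ?m = "\<lambda>i. gradient (log_partition \<nu> b) (X i *v \<beta>)"
  have y [measurable]: "y i \<in> borel_measurable M" if "1 \<le> i" for i
    using distributed_measurable[OF density[OF that]] sets_\<nu> by (simp cong: measurable_cong_sets)
  have dpos: "0 < moment (\<lambda>_. 1) \<theta>" if "\<theta> \<in> dom" for \<theta>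
    using moment_one_pos that by blast
  \<comment> \<open>Continuity and compactness give one bound \<open>V\<close> on the second moment
    of the responses for all regressors.\<close>
  have "continuous_on dom (\<lambda>\<theta>. moment (\<lambda>y. norm y * norm y) \<theta> / moment (\<lambda>_. 1) \<theta>)"
    using dpos by (intro continuous_intros continuous_on_moment subexponential_mult
        subexponential_norm subexponential_const) (auto, metis less_irrefl)
  then have "continuous_on \<X> (\<lambda>Z. moment (\<lambda>y. norm y * norm y) (Z *v \<beta>) / moment (\<lambda>_. 1) (Z *v \<beta>))"
    by (rule continuous_on_compose2) (auto intro!: continuous_intros dom)
  then have "bounded ((\<lambda>Z. moment (\<lambda>y. norm y * norm y) (Z *v \<beta>) / moment (\<lambda>_. 1) (Z *v \<beta>)) ` \<X>)"
    using \<open>compact \<X>\<close> by (intro compact_imp_bounded compact_continuous_image)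
  then obtain V where V: "0 < V"
    "\<And>Z. Z \<in> \<X> \<Longrightarrow> \<bar>moment (\<lambda>y. norm y * norm y) (Z *v \<beta>) / moment (\<lambda>_. 1) (Z *v \<beta>)\<bar> \<le> V"
    unfolding bounded_pos by auto
  obtain R where R: "0 < R" "\<And>Z. Z \<in> \<X> \<Longrightarrow> norm Z \<le> R"
    using compact_imp_bounded[OF \<open>compact \<X>\<close>] bounded_pos by metis
  define C where "C = real CARD('p) * (R\<^sup>2 * V)"
  have C: "0 < C"
    using R V unfolding C_def by (intro mult_pos_pos) auto

  have coord: "integrable M (\<lambda>\<omega>. (?U n \<omega> $ k)\<^sup>2) \<and> expectation (\<lambda>\<omega>. (?U n \<omega> $ k)\<^sup>2) \<le> real n * (R\<^sup>2 * V)" for n k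
  proof -
    let ?u = "axis k 1 :: real ^ 'p"
    let ?\<xi> = "\<lambda>i \<omega>. (y i \<omega> - ?m i) \<bullet> (X i *v ?u)"
    have "indep_vars (\<lambda>_. borel) (\<lambda>i \<omega>. (\<lambda>v. (v - ?m i) \<bullet> (X i *v ?u)) (y i \<omega>)) {1..n}"
      by (rule indep_vars_compose2[OF indep_vars_subset[OF indep]]) auto
    then have ind: "indep_vars (\<lambda>_. borel) ?\<xi> {1..n}" by simp
    have \<xi>: "integrable M (?\<xi> i)" "expectation (?\<xi> i) = 0" "integrable M (\<lambda>\<omega>. (?\<xi> i \<omega>)\<^sup>2)"
      "expectation (\<lambda>\<omega>. (?\<xi> i \<omega>)\<^sup>2) \<le> R\<^sup>2 * V" if "i \<in> {1..n}" for i
    proof -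
      have i: "1 \<le> i" using that by simp
      note cp = centered_projection[OF \<open>prob_space M\<close> density[OF i] dom[OF X[OF i]], of "X i *v ?u"]
      show "integrable M (?\<xi> i)" "expectation (?\<xi> i) = 0" "integrable M (\<lambda>\<omega>. (?\<xi> i \<omega>)\<^sup>2)"
        using cp by auto
      have "norm (X i *v ?u) \<le> norm (X i) * norm ?u"
        by (rule norm_matrix_vector_le)
      also have "\<dots> \<le> R"
        using R(2)[OF X[OF i]] by simp
      finally have "(norm (X i *v ?u))\<^sup>2 \<le> R\<^sup>2"
        by (intro power_mono) auto
      then have "(norm (X i *v ?u))\<^sup>2 * (moment (\<lambda>y. norm y * norm y) (X i *v \<beta>) / moment (\<lambda>_. 1) (X i *v \<beta>))
          \<le> R\<^sup>2 * V"
        using V(2)[OF X[OF i]] V(1) order_trans[OF mult_left_mono mult_right_mono]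
        by (meson abs_le_D1 less_imp_le zero_le_power2)
      with cp(4) show "expectation (\<lambda>\<omega>. (?\<xi> i \<omega>)\<^sup>2) \<le> R\<^sup>2 * V"
        by linarith
    qed
    have eq: "?U n \<omega> $ k = (\<Sum>i=1..n. ?\<xi> i \<omega>)" for \<omega>
      unfolding cart_eq_inner_axis inner_score ..
    have "(\<Sum>i=1..n. expectation (\<lambda>\<omega>. (?\<xi> i \<omega>)\<^sup>2)) \<le> (\<Sum>i=1..n. R\<^sup>2 * V)"
      using \<xi>(4) by (intro sum_mono)
    then show ?thesis
      using expectation_square_sum_indep[OF _ ind \<xi>(1,3,2)] by (simp add: eq)
  qed
  have norm_eq: "(norm (?U n \<omega>))\<^sup>2 = (\<Sum>k\<in>UNIV. (?U n \<omega> $ k)\<^sup>2)" for n \<omega>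
    unfolding power2_norm_eq_inner inner_vec_def by (simp add: power2_eq_square)
  have int: "integrable M (\<lambda>\<omega>. (norm (?U n \<omega>))\<^sup>2)" for n
    unfolding norm_eq using coord by (intro Bochner_Integration.integrable_sum) auto
  have E: "expectation (\<lambda>\<omega>. (norm (?U n \<omega>))\<^sup>2) \<le> real n * C" for n
  proof -
    have "expectation (\<lambda>\<omega>. (norm (?U n \<omega>))\<^sup>2) = (\<Sum>k\<in>UNIV. expectation (\<lambda>\<omega>. (?U n \<omega> $ k)\<^sup>2))"
      unfolding norm_eq using coord by (intro Bochner_Integration.integral_sum) auto
    also have "\<dots> \<le> (\<Sum>k\<in>(UNIV :: 'p set). real n * (R\<^sup>2 * V))"
      using coord by (intro sum_mono) auto
    finally show ?thesis by (simp add: C_def mult_ac)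
  qed
  \<comment> \<open>Chosen so that the Markov bound \<open>C / K\<^sup>2\<close> equals
    \<epsilon>.\<close>
  define K where "K = sqrt (C / \<epsilon>)"
  have K: "0 < K" "K\<^sup>2 = C / \<epsilon>"
    using C \<open>0 < \<epsilon>\<close> by (auto simp: K_def)
  have "prob {\<omega> \<in> space M. K * sqrt (real n) < norm (?U n \<omega>)} \<le> \<epsilon>" if "1 \<le> n" for n
  proof -
    have pos: "0 < K\<^sup>2 * real n"
      using K(1) that by (intro mult_pos_pos) auto
    have "prob {\<omega> \<in> space M. K * sqrt (real n) < norm (?U n \<omega>)}
        \<le> prob {\<omega> \<in> space M. K\<^sup>2 * real n \<le> (norm (?U n \<omega>))\<^sup>2}"
    proof (rule finite_measure_mono)
      have "K\<^sup>2 * real n \<le> x\<^sup>2" if "K * sqrt (real n) < x" for x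
        using power_mono[OF less_imp_le[OF that], of 2] K by (simp add: power_mult_distrib)
      then show "{\<omega> \<in> space M. K * sqrt (real n) < norm (?U n \<omega>)}
          \<subseteq> {\<omega> \<in> space M. K\<^sup>2 * real n \<le> (norm (?U n \<omega>))\<^sup>2}"
        by blast
      show "{\<omega> \<in> space M. K\<^sup>2 * real n \<le> (norm (?U n \<omega>))\<^sup>2} \<in> events"
        using measurable_score[OF y] by measurable
    qed
    also have "\<dots> \<le> expectation (\<lambda>\<omega>. (norm (?U n \<omega>))\<^sup>2) / (K\<^sup>2 * real n)"
      by (rule integral_Markov_inequality_measure[OF int, where A = "space M"]) (use pos in auto)
    also have "\<dots> \<le> (real n * C) / (K\<^sup>2 * real n)"
      using E pos by (intro divide_right_mono) auto
    also have "\<dots> = \<epsilon>"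
      using K C that \<open>0 < \<epsilon>\<close> by simp
    finally show ?thesis .
  qed
  then show ?thesis
    using K by (intro exI[of _ K]) auto
qed

end

section \<open>Quadratic bounds for the log-likelihood\<close>

lemma convex_on_sum_fun:
  assumes "convex S" "\<And>i. i \<in> I \<Longrightarrow> convex_on S (f i)"
  shows "convex_on S (\<lambda>x. \<Sum>i\<in>I. f i x)"
  using assms(2) by (induction I rule: infinite_finite_induct) (auto simp: convex_on_const assms(1))

context natural_exp_family
begin

text \<open>Adding and subtracting the gradient of the log-partition function collects all
  dependence on the responses in the linear score term; the terms \<open>b (y i)\<close>
  cancel.\<close>

lemma neg_log_lik_diff:
  fixes X :: "nat \<Rightarrow> real ^ 'p ^ 'r"
  shows "- (\<Sum>i=1..n. log_lik \<nu> b (X i) (y i) \<beta>) - (- (\<Sum>i=1..n. log_lik \<nu> b (X i) (y i) \<beta>\<^sub>0)) =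
    (\<Sum>i=1..n. log_partition \<nu> b (X i *v \<beta>) - log_partition \<nu> b (X i *v \<beta>\<^sub>0)
      - gradient (log_partition \<nu> b) (X i *v \<beta>\<^sub>0) \<bullet> (X i *v (\<beta> - \<beta>\<^sub>0)))
    - score X y \<beta>\<^sub>0 n \<bullet> (\<beta> - \<beta>\<^sub>0)"
  unfolding inner_score log_lik_def sum_negf[symmetric] sum_subtractf[symmetric]
  by (intro sum.cong) (simp_all add: inner_simps matrix_vector_mult_diff_distrib)

text \<open>Apart from the score term the difference does not depend on the responses, so the
  threshold on \<open>n\<close> is the same for all \<open>y\<close>. The averaged information
  supplies the curvature.\<close>

lemma neg_log_lik_quadratic_bounds:
  fixes X :: "nat \<Rightarrow> real ^ 'p ^ 'r"
  assumes "compact \<X>" "open B" "\<beta>\<^sub>0 \<in> B" and X: "\<And>i. 1 \<le> i \<Longrightarrow> X i \<in> \<X>"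
    and dom: "\<And>Z \<beta>. Z \<in> \<X> \<Longrightarrow> \<beta> \<in> B \<Longrightarrow> Z *v \<beta> \<in> dom"
    and lim: "(\<lambda>n. (1 / real n) *\<^sub>R (\<Sum>i=1..n. information \<nu> b \<beta>\<^sub>0 (X i))) \<longlonglongrightarrow> J"
    and J: "positive_definite J"
  shows "\<exists>\<delta>>0. \<exists>c>0. \<exists>C\<ge>0. cball \<beta>\<^sub>0 \<delta> \<subseteq> B \<and> (\<forall>\<^sub>F n in sequentially. \<forall>y. \<forall>\<beta>\<in>cball \<beta>\<^sub>0 \<delta>.
    let d = - (\<Sum>i=1..n. log_lik \<nu> b (X i) (y i) \<beta>) - (- (\<Sum>i=1..n. log_lik \<nu> b (X i) (y i) \<beta>\<^sub>0));
        h = norm (\<beta> - \<beta>\<^sub>0); s = norm (score X y \<beta>\<^sub>0 n)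
    in c * real n * h\<^sup>2 - s * h \<le> d \<and> d \<le> C * real n * h\<^sup>2 + s * h)"
proof -
  define A where "A = (\<lambda>n. (1 / real n) *\<^sub>R (\<Sum>i=1..n. information \<nu> b \<beta>\<^sub>0 (X i)))"
  obtain c C where c: "0 < c" and C: "0 \<le> C" and ev: "\<forall>\<^sub>F n in sequentially. \<forall>v.
      c * (norm v)\<^sup>2 \<le> v \<bullet> (A n *v v) \<and> v \<bullet> (A n *v v) \<le> C * (norm v)\<^sup>2"
    using tendsto_positive_definite[OF lim J] unfolding A_def by blast
  \<comment> \<open>The Taylor factor 1/2 leaves curvature \<open>c / 2\<close>; an approximation
    error of \<open>c / 4\<close> keeps \<open>c / 4\<close> in the lower bound and gives
    \<open>C / 2 + c / 4\<close> in the upper one.\<close>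
  have "0 < c / 4" using c by simp
  from log_partition_uniform_quadratic[OF assms(1-3) this dom]
  obtain \<delta> where \<delta>: "0 < \<delta>" "cball \<beta>\<^sub>0 \<delta> \<subseteq> B" and quad: "\<forall>Z\<in>\<X>. \<forall>\<beta>\<in>cball \<beta>\<^sub>0 \<delta>.
    \<bar>log_partition \<nu> b (Z *v \<beta>) - log_partition \<nu> b (Z *v \<beta>\<^sub>0)
      - gradient (log_partition \<nu> b) (Z *v \<beta>\<^sub>0) \<bullet> (Z *v (\<beta> - \<beta>\<^sub>0))
      - (\<beta> - \<beta>\<^sub>0) \<bullet> (information \<nu> b \<beta>\<^sub>0 Z *v (\<beta> - \<beta>\<^sub>0)) / 2\<bar> \<le> c / 4 * (norm (\<beta> - \<beta>\<^sub>0))\<^sup>2"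
    by blast
  have "\<forall>\<^sub>F n in sequentially. \<forall>y. \<forall>\<beta>\<in>cball \<beta>\<^sub>0 \<delta>.
    let d = - (\<Sum>i=1..n. log_lik \<nu> b (X i) (y i) \<beta>) - (- (\<Sum>i=1..n. log_lik \<nu> b (X i) (y i) \<beta>\<^sub>0));
        h = norm (\<beta> - \<beta>\<^sub>0); s = norm (score X y \<beta>\<^sub>0 n)
    in c / 4 * real n * h\<^sup>2 - s * h \<le> d \<and> d \<le> (C / 2 + c / 4) * real n * h\<^sup>2 + s * h"
    using ev eventually_ge_at_top[of 1]
  proof eventually_elim
    case (elim n)
    show ?case
    proof (intro allI ballI)
      fix y \<beta> assume \<beta>: "\<beta> \<in> cball \<beta>\<^sub>0 \<delta>"
      define h where "h = \<beta> - \<beta>\<^sub>0"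
      define e where "e = (\<lambda>i. log_partition \<nu> b (X i *v \<beta>) - log_partition \<nu> b (X i *v \<beta>\<^sub>0)
        - gradient (log_partition \<nu> b) (X i *v \<beta>\<^sub>0) \<bullet> (X i *v h))"
      define q where "q = (\<lambda>i. h \<bullet> (information \<nu> b \<beta>\<^sub>0 (X i) *v h))"
      have "\<bar>e i - q i / 2\<bar> \<le> c / 4 * (norm h)\<^sup>2" if "i \<in> {1..n}" for i
        using quad[rule_format, OF X \<beta>, of i] that by (simp add: e_def q_def h_def)
      then have "\<bar>\<Sum>i=1..n. e i - q i / 2\<bar> \<le> (\<Sum>i=1..n. c / 4 * (norm h)\<^sup>2)"
        by (intro order_trans[OF sum_abs] sum_mono)
      then have eq: "\<bar>(\<Sum>i=1..n. e i) - (\<Sum>i=1..n. q i) / 2\<bar> \<le> c / 4 * real n * (norm h)\<^sup>2"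
        by (simp add: sum_subtractf sum_divide_distrib mult_ac)
      have "(\<Sum>i=1..n. q i) = real n * (h \<bullet> (A n *v h))"
        using elim(2) by (simp add: A_def q_def matrix_vector_mult_sum_distrib inner_sum_right
            scaleR_matrix_vector_assoc[symmetric])
      moreover have "real n * (c * (norm h)\<^sup>2) \<le> real n * (h \<bullet> (A n *v h))"
        "real n * (h \<bullet> (A n *v h)) \<le> real n * (C * (norm h)\<^sup>2)"
        using elim(1) by (auto intro!: mult_left_mono)
      ultimately have "c * real n * (norm h)\<^sup>2 \<le> (\<Sum>i=1..n. q i)" "(\<Sum>i=1..n. q i) \<le> C * real n * (norm h)\<^sup>2"
        by (simp_all add: mult_ac)
      moreover have quarter: "c / 4 * real n * (norm h)\<^sup>2 = (c * real n * (norm h)\<^sup>2) / 4"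
        and upper: "(C / 2 + c / 4) * real n * (norm h)\<^sup>2
          = (C * real n * (norm h)\<^sup>2) / 2 + (c * real n * (norm h)\<^sup>2) / 4"
        by (simp_all add: distrib_right)
      moreover have "\<bar>score X y \<beta>\<^sub>0 n \<bullet> h\<bar> \<le> norm (score X y \<beta>\<^sub>0 n) * norm h"
        by (rule Cauchy_Schwarz_ineq2)
      ultimately show "let d = - (\<Sum>i=1..n. log_lik \<nu> b (X i) (y i) \<beta>) - (- (\<Sum>i=1..n. log_lik \<nu> b (X i) (y i) \<beta>\<^sub>0));
            h = norm (\<beta> - \<beta>\<^sub>0); s = norm (score X y \<beta>\<^sub>0 n)
        in c / 4 * real n * h\<^sup>2 - s * h \<le> d \<and> d \<le> (C / 2 + c / 4) * real n * h\<^sup>2 + s * h"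
        using eq unfolding neg_log_lik_diff h_def[symmetric] Let_def e_def[symmetric] quarter upper abs_le_iff
        by linarith
    qed
  qed
  then show ?thesis
    using \<delta> c C by (intro exI[of _ \<delta>] conjI exI[of _ "c / 4"] exI[of _ "C / 2 + c / 4"]) auto
qed

text \<open>The response terms are affine in \<beta>, so convexity is inherited from the
  log-partition terms.\<close>

lemma convex_on_neg_log_lik:
  fixes X :: "nat \<Rightarrow> real ^ 'p ^ 'r"
  assumes "convex B" and dom: "\<And>i \<beta>. 1 \<le> i \<Longrightarrow> \<beta> \<in> B \<Longrightarrow> X i *v \<beta> \<in> dom"
    and pd: "\<And>\<theta>. \<theta> \<in> dom \<Longrightarrow> positive_definite (hessian (log_partition \<nu> b) \<theta>)"
  shows "convex_on B (\<lambda>\<beta>. - (\<Sum>i=1..n. log_lik \<nu> b (X i) (y i) \<beta>))"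
proof -
  have "convex_on B (\<lambda>\<beta>. log_partition \<nu> b (X i *v \<beta>) + (- (y i \<bullet> (X i *v \<beta>)) - b (y i)))" if "i \<in> {1..n}" for i
  proof (intro convex_on_add convex_on_log_partition_regression assms)
    show "convex_on B (\<lambda>\<beta>. - (y i \<bullet> (X i *v \<beta>)) - b (y i))"
      using \<open>convex B\<close>
      by (intro convex_onI)
        (simp_all add: matrix_vector_right_distrib matrix_vector_mult_scaleR inner_add_right algebra_simps)
  qed (use that in auto)
  with \<open>convex B\<close> have "convex_on B (\<lambda>\<beta>. \<Sum>i=1..n. log_partition \<nu> b (X i *v \<beta>) + (- (y i \<bullet> (X i *v \<beta>)) - b (y i)))"
    by (rule convex_on_sum_fun)
  then show ?thesis
    by (simp add: log_lik_def sum_negf[symmetric] algebra_simps)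
qed

end

section \<open>Probability of correct selection\<close>

theorem theorem6:
  fixes \<nu> :: "(real ^ 'r) measure"
    and b :: "real ^ 'r \<Rightarrow> real"
    and M :: "'w measure"
    and y :: "nat \<Rightarrow> 'w \<Rightarrow> real ^ 'r"
    and X :: "nat \<Rightarrow> real ^ 'p ^ 'r"
    and \<X> :: "(real ^ 'p ^ 'r) set"
    and B :: "(real ^ 'p) set"
    and \<beta>s :: "real ^ 'p"
    and \<mu> :: "(real ^ 'p ^ 'r) measure"
    and \<gamma> \<gamma>\<^sub>0 \<kappa> :: real
    and \<beta>hat :: "nat \<Rightarrow> 'w \<Rightarrow> real ^ 'p"
  assumes "sigma_finite_measure \<nu>"
    and "sets \<nu> = sets borel"
    and "b \<in> borel_measurable borel"
    and variance_pos_def: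
      "\<forall>\<theta> \<in> interior (natural_parameter_space \<nu> b).
         positive_definite (hessian (log_partition \<nu> b) \<theta>)"
    and "open B" and "convex B" and "\<beta>s \<in> B"
    and "\<forall>i\<ge>1. X i \<in> \<X>"
    and "prob_space M"
    and indep: "prob_space.indep_vars M (\<lambda>_. borel) y {1..}"
    and density:
      "\<forall>i\<ge>1. distributed M \<nu> (y i) (\<lambda>v. ennreal (nef_density \<nu> b (X i *v \<beta>s) v))"
    and C1: "compact \<X>"
      "\<forall>Z\<in>\<X>. \<forall>\<beta>\<in>B. Z *v \<beta> \<in> interior (natural_parameter_space \<nu> b)"
    and C2: "prob_space \<mu>" "sets \<mu> = sets borel" "measure \<mu> \<X> = 1"
      "\<forall>\<beta>\<in>B. (\<lambda>n. (1 / real n) *\<^sub>R (\<Sum>i=1..n. information \<nu> b \<beta> (X i)))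
                \<longlonglongrightarrow> (LINT Z:\<X>|\<mu>. information \<nu> b \<beta> Z)"
      "\<forall>\<beta>\<in>B. positive_definite (LINT Z:\<X>|\<mu>. information \<nu> b \<beta> Z)"
    and "0 < \<gamma>" and "\<gamma> < 1"
    and "\<gamma> < \<gamma>\<^sub>0" and "\<gamma>\<^sub>0 \<le> 1"
    and "0 < \<kappa>"
    and "\<forall>n. \<beta>hat n \<in> borel_measurable M"
    and bridge_estimator:
      "\<forall>n\<ge>1. \<forall>\<omega>\<in>space M.
         let obj = bridge_objective \<nu> b X (\<lambda>i. y i \<omega>) \<gamma> (real n powr ((\<gamma>\<^sub>0 - 2) / 2) * \<kappa>) n
         in (\<exists>\<beta>. is_arg_min obj (\<lambda>\<beta>. \<beta> \<in> B) \<beta>) \<longrightarrow>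
              is_arg_min obj (\<lambda>\<beta>. \<beta> \<in> B) (\<beta>hat n \<omega>)"
  shows "(\<lambda>n. \<P>(\<omega> in M. {j. \<beta>hat n \<omega> $ j \<noteq> 0} = {j. \<beta>s $ j \<noteq> 0})) \<longlonglongrightarrow> 1"
proof -
  interpret nef: natural_exp_family \<nu> b
    using assms(2,3) by unfold_locales
  interpret prob_space M by fact
  let ?J = "LINT Z:\<X>|\<mu>. information \<nu> b \<beta>s Z"
  let ?T = "\<lambda>n. {\<omega> \<in> space M. {j. \<beta>hat n \<omega> $ j \<noteq> 0} = {j. \<beta>s $ j \<noteq> 0}}"
  let ?U = "\<lambda>n \<omega>. nef.score X (\<lambda>i. y i \<omega>) \<beta>s n"
  have X: "X i \<in> \<X>" if "1 \<le> i" for i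
    using \<open>\<forall>i\<ge>1. X i \<in> \<X>\<close> that by blast
  have dom: "Z *v \<beta> \<in> nef.dom" if "Z \<in> \<X>" "\<beta> \<in> B" for Z \<beta>
    using C1(2) that by blast
  have y: "y i \<in> borel_measurable M" if "1 \<le> i" for i
    using distributed_measurable[OF density[rule_format, OF that]] \<open>sets \<nu> = sets borel\<close>
    by (simp cong: measurable_cong_sets)
  have T: "?T n \<in> events" for n
  proof -
    have [measurable]: "\<beta>hat n \<in> borel_measurable M"
      using \<open>\<forall>n. \<beta>hat n \<in> borel_measurable M\<close> by blast
    have [measurable]: "(\<lambda>\<omega>. \<beta>hat n \<omega> $ j) \<in> borel_measurable M" for j
      unfolding cart_eq_inner_axis by measurable
    have "?T n = {\<omega> \<in> space M. \<forall>j. \<beta>hat n \<omega> $ j \<noteq> 0 \<longleftrightarrow> \<beta>s $ j \<noteq> 0}"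
      by auto
    also have "\<dots> \<in> events"
      by measurable
    finally show ?thesis .
  qed
  obtain \<delta> c C where \<delta>: "0 < \<delta>" "cball \<beta>s \<delta> \<subseteq> B" and c: "0 < c" "0 \<le> C" and
    quad: "\<forall>\<^sub>F n in sequentially. \<forall>y. \<forall>\<beta>\<in>cball \<beta>s \<delta>.
    let d = - (\<Sum>i=1..n. log_lik \<nu> b (X i) (y i) \<beta>) - (- (\<Sum>i=1..n. log_lik \<nu> b (X i) (y i) \<beta>s));
        h = norm (\<beta> - \<beta>s); s = norm (nef.score X y \<beta>s n)
    in c * real n * h\<^sup>2 - s * h \<le> d \<and> d \<le> C * real n * h\<^sup>2 + s * h"
    using nef.neg_log_lik_quadratic_bounds[of \<X> B \<beta>s X ?J] C1(1) C2(4,5) \<open>open B\<close> \<open>\<beta>s \<in> B\<close> X dom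
    by blast

  \<comment> \<open>For fixed \<epsilon> the score is at most \<open>K * sqrt n\<close> in norm with
    probability at least \<open>1 - \<epsilon>\<close>; on that event the deterministic support
    lemma applies.\<close>
  have "\<forall>\<^sub>F n in sequentially. 1 - \<epsilon> \<le> prob (?T n)" if \<epsilon>: "0 < \<epsilon>" for \<epsilon>
  proof -
    have "\<exists>K\<ge>0. \<forall>n\<ge>1. \<P>(\<omega> in M. K * sqrt (real n) < norm (?U n \<omega>)) \<le> \<epsilon>"
      by (rule nef.score_tight[OF \<open>prob_space M\<close> C1(1) X dom[OF _ \<open>\<beta>s \<in> B\<close>] indep _ \<epsilon>]) (use density in auto)
    then obtain K where K: "0 \<le> K"
      "\<And>n. 1 \<le> n \<Longrightarrow> \<P>(\<omega> in M. K * sqrt (real n) < norm (?U n \<omega>)) \<le> \<epsilon>"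
      by blast
    have sqrt_top: "filterlim (\<lambda>n. sqrt (real n)) at_top sequentially"
      by (rule filterlim_compose[OF sqrt_at_top filterlim_real_sequentially])
    \<comment> \<open>The deterministic lemma is used at \<open>N = sqrt n\<close>. Its threshold
      depends on \<open>K\<close> but not on the loss, so it holds for all outcomes at once.\<close>
    note ev = eventually_compose_filterlim[OF bridge_argmin_support[OF \<open>open B\<close> \<delta>(2,1) c(1) K(1) c(2)
      \<open>0 < \<kappa>\<close> \<open>0 < \<gamma>\<close> \<open>\<gamma> < 1\<close> \<open>\<gamma> < \<gamma>\<^sub>0\<close> \<open>\<gamma>\<^sub>0 \<le> 1\<close>] sqrt_top]
    show ?thesis
      using ev quad eventually_ge_at_top[of 1]
    proof eventually_elim
      case (elim n)
      have support: "\<omega> \<in> ?T n" if \<omega>: "\<omega> \<in> space M" and U: "norm (?U n \<omega>) \<le> K * sqrt (real n)" for \<omega>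
      proof -
        let ?L = "\<lambda>\<beta>. - (\<Sum>i=1..n. log_lik \<nu> b (X i) (y i \<omega>) \<beta>)"
        let ?obj = "bridge_objective \<nu> b X (\<lambda>i. y i \<omega>) \<gamma> (real n powr ((\<gamma>\<^sub>0 - 2) / 2) * \<kappa>) n"
        have conv: "convex_on B ?L"
          using variance_pos_def dom X
          by (intro nef.convex_on_neg_log_lik[where y = "\<lambda>i. y i \<omega>"] \<open>convex B\<close>) auto
        have bounds: "c * (sqrt (real n))\<^sup>2 * (norm (\<beta> - \<beta>s))\<^sup>2 - K * sqrt (real n) * norm (\<beta> - \<beta>s) \<le> ?L \<beta> - ?L \<beta>s \<and>
          ?L \<beta> - ?L \<beta>s \<le> C * (sqrt (real n))\<^sup>2 * (norm (\<beta> - \<beta>s))\<^sup>2 + K * sqrt (real n) * norm (\<beta> - \<beta>s)"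
          if "\<beta> \<in> cball \<beta>s \<delta>" for \<beta>
          using elim(2)[rule_format, OF that, of "\<lambda>i. y i \<omega>"] mult_right_mono[OF U norm_ge_zero[of "\<beta> - \<beta>s"]]
          by (simp add: Let_def)
        \<comment> \<open>The total penalty weight is \<open>\<kappa>\<close> times \<open>n\<close>
          to the power \<open>\<gamma>\<^sub>0 / 2\<close>, that is, \<open>sqrt n\<close> to the
          power \<open>\<gamma>\<^sub>0\<close>.\<close>
        have "real n * (real n powr ((\<gamma>\<^sub>0 - 2) / 2) * \<kappa>) = \<kappa> * sqrt (real n) powr \<gamma>\<^sub>0"
        proof -
          have "real n * real n powr ((\<gamma>\<^sub>0 - 2) / 2) = real n powr (1 + (\<gamma>\<^sub>0 - 2) / 2)"
            using elim(3) by (simp add: powr_mult_base)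
          also have "1 + (\<gamma>\<^sub>0 - 2) / 2 = 1 / 2 * \<gamma>\<^sub>0"
            by (simp add: field_simps)
          also have "real n powr (1 / 2 * \<gamma>\<^sub>0) = (real n powr (1 / 2)) powr \<gamma>\<^sub>0"
            by (simp only: powr_powr)
          also have "real n powr (1 / 2) = sqrt (real n)"
            by (simp add: powr_half_sqrt)
          finally show ?thesis by simp
        qed
        then have obj: "?obj \<beta> = ?L \<beta> + \<kappa> * sqrt (real n) powr \<gamma>\<^sub>0 * (\<Sum>j\<in>UNIV. \<bar>\<beta> $ j\<bar> powr \<gamma>)" for \<beta>
          by (simp add: bridge_objective_def)
        have "(\<exists>\<beta>. is_arg_min ?obj (\<lambda>\<beta>. \<beta> \<in> B) \<beta>) \<and>
          (\<forall>\<beta>. is_arg_min ?obj (\<lambda>\<beta>. \<beta> \<in> B) \<beta> \<longrightarrow> {j. \<beta> $ j \<noteq> 0} = {j. \<beta>s $ j \<noteq> 0})"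
          using elim(1)[rule_format, OF conv bounds obj] by blast
        \<comment> \<open>The hypothesis on \<open>\<beta>hat\<close> takes effect only when a
          minimizer exists, so both the existence and the support part of the conclusion are
          needed.\<close>
        then show ?thesis
          using bridge_estimator elim(3) \<omega> by (auto simp: Let_def)
      qed
      have E: "{\<omega> \<in> space M. K * sqrt (real n) < norm (?U n \<omega>)} \<in> events"
        using nef.measurable_score[OF y, where X = X and \<beta> = \<beta>s and n = n] by measurable
      have "1 - \<epsilon> \<le> 1 - prob {\<omega> \<in> space M. K * sqrt (real n) < norm (?U n \<omega>)}"
        using K(2) elim(3) by simp
      also have "\<dots> = prob (space M - {\<omega> \<in> space M. K * sqrt (real n) < norm (?U n \<omega>)})"
        using prob_compl[OF E] by simp
      also have "\<dots> \<le> prob (?T n)"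
        by (intro finite_measure_mono subsetI support T) (auto simp: not_less)
      finally show ?case .
    qed
  qed
  note lower = this
  show ?thesis
  proof (rule order_tendstoI)
    fix a :: real assume "a < 1"
    \<comment> \<open>Taking half of the gap to 1 gives the lower bound \<open>(1 + a) / 2\<close>,
      which is strictly above \<open>a\<close>.\<close>
    then have "\<forall>\<^sub>F n in sequentially. 1 - (1 - a) / 2 \<le> prob (?T n)"
      by (intro lower) simp
    then show "\<forall>\<^sub>F n in sequentially. a < prob (?T n)"
      by eventually_elim (use \<open>a < 1\<close> in \<open>simp add: field_simps\<close>)
  next
    fix a :: real assume "1 < a"
    then show "\<forall>\<^sub>F n in sequentially. prob (?T n) < a"
      using prob_le_1 by (intro always_eventually allI) (meson le_less_trans)
  qed
qed

end
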